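(* Let $S$ be a multi-dimensional elephant random walk on $\mathbb{Z}^2$ with parameter $p=5/8$. Then, almost surely, $$\lim_{n\to\infty}\frac{\log\|S_n\|^2}{\log n}=1 .$$
   Context: Multi-dimensional elephant random walk (MERW) on $\mathbb{Z}^d$ (here $d=2$): let $e_1,\dots,e_d$ be the standard basis of $\mathbb{R}^d$ and $p\in[0,1]$. Set $S_0=0$ and $S_1=\sigma_1=e_1$. For each $n\ge 1$, choose $n'$ uniformly at random in $\{1,\dots,n\}$ (independently of the past); given the past and $n'$, let $\sigma_{n+1}=\sigma_{n'}$ with probability $p$, and $\sigma_{n+1}=\sigma$ with probability $\frac{1-p}{2d-1}$ for each $\sigma\in\{\pm e_1,\dots,\pm e_d\}\setminus\{\sigma_{n'}\}$. Set $S_{n+1}=S_n+\sigma_{n+1}$. $\|\cdot\|$ is the Euclidean norm; $\log 0=-\infty$ (so the statement includes that almost surely $S_n\ne0$ for all large $n$). *)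

theory Defs
  imports "HOL-Probability.Probability"
begin

definition unit_steps :: "(real ^ 'd) set" where
  "unit_steps = (\<Union>i. {axis i 1, - axis i 1})"

text \<open>
  Information available before the random index \<open>K n\<close> is drawn: the steps
  \<open>\<sigma> 1, \<dots>, \<sigma> n\<close> and the earlier indices \<open>K 1, \<dots>, K (n - 1)\<close>. In \<open>past_mem\<close>
  the index \<open>K n\<close> itself (called \<open>n'\<close> in the usual description) is known as well.
\<close>

definition past_gen :: "'a measure \<Rightarrow> (nat \<Rightarrow> 'a \<Rightarrow> real ^ 'd) \<Rightarrow> (nat \<Rightarrow> 'a \<Rightarrow> nat) \<Rightarrow> nat \<Rightarrow> 'a set set" where
  "past_gen M \<sigma> K n =
     (\<Union>i\<in>{1..n}. sets (vimage_algebra (space M) (\<sigma> i) borel)) \<union>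
     (\<Union>i\<in>{1..<n}. sets (vimage_algebra (space M) (K i) (count_space UNIV)))"

definition past :: "'a measure \<Rightarrow> (nat \<Rightarrow> 'a \<Rightarrow> real ^ 'd) \<Rightarrow> (nat \<Rightarrow> 'a \<Rightarrow> nat) \<Rightarrow> nat \<Rightarrow> 'a measure" where
  "past M \<sigma> K n = sigma (space M) (past_gen M \<sigma> K n)"

definition past_mem :: "'a measure \<Rightarrow> (nat \<Rightarrow> 'a \<Rightarrow> real ^ 'd) \<Rightarrow> (nat \<Rightarrow> 'a \<Rightarrow> nat) \<Rightarrow> nat \<Rightarrow> 'a measure" where
  "past_mem M \<sigma> K n = sigma (space M)
     (past_gen M \<sigma> K n \<union> sets (vimage_algebra (space M) (K n) (count_space UNIV)))"

text \<open>
  Multi-dimensional elephant random walk. The values of \<open>\<sigma> 0\<close> and \<open>K 0\<close> play no role. The index \<open>1 :: 'd\<close> serves as the index of \<open>e\<^sub>1\<close>.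
\<close>

locale merw = prob_space M
  for M :: "'a measure" +
  fixes p :: real
    and \<sigma> :: "nat \<Rightarrow> 'a \<Rightarrow> real ^ ('d :: {finite, one})"
    and K :: "nat \<Rightarrow> 'a \<Rightarrow> nat"
    and S :: "nat \<Rightarrow> 'a \<Rightarrow> real ^ ('d :: {finite, one})"
  assumes p_range: "0 \<le> p" "p \<le> 1"
    and measurable_step: "\<And>n. n \<ge> 1 \<Longrightarrow> random_variable borel (\<sigma> n)"
    and measurable_index: "\<And>n. n \<ge> 1 \<Longrightarrow> random_variable (count_space UNIV) (K n)"
    and walk_0: "\<And>\<omega>. \<omega> \<in> space M \<Longrightarrow> S 0 \<omega> = 0"
    and first_step: "\<And>\<omega>. \<omega> \<in> space M \<Longrightarrow> \<sigma> 1 \<omega> = axis 1 1"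
    and walk_Suc: "\<And>n \<omega>. \<omega> \<in> space M \<Longrightarrow> S (Suc n) \<omega> = S n \<omega> + \<sigma> (Suc n) \<omega>"
    and index_uniform: "\<And>n. n \<ge> 1 \<Longrightarrow>
          distr M (count_space UNIV) (K n) = measure_pmf (pmf_of_set {1..n})"
    and index_indep: "\<And>n. n \<ge> 1 \<Longrightarrow>
          indep_set (sets (past M \<sigma> K n)) (sets (vimage_algebra (space M) (K n) (count_space UNIV)))"
    and step_law: "\<And>n v. n \<ge> 1 \<Longrightarrow> v \<in> unit_steps \<Longrightarrow>
          AE \<omega> in M. real_cond_exp M (past_mem M \<sigma> K n)
              (indicator {\<omega> \<in> space M. \<sigma> (Suc n) \<omega> = v}) \<omega>
            = (if v = \<sigma> (K n \<omega>) \<omega> then p else (1 - p) / (2 * real CARD('d) - 1))"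

text \<open>Logarithm with the convention \<open>log 0 = -\<infinity>\<close>; in contrast, \<open>ln 0 = 0\<close> in the library.\<close>

definition eln :: "real \<Rightarrow> ereal" where
  "eln x = (if x > 0 then ereal (ln x) else - \<infinity>)"

end

theory Submission
  imports Defs "HOL-Analysis.Harmonic_Numbers" "HOL-Real_Asymp.Real_Asymp"
begin

text \<open>
  The proof works in discrete time with Lyapunov functions of the whole history of steps.

  With \<open>p = 5 / 8\<close> and \<open>d = 2\<close> the walk is critical: given the first \<open>n\<close> steps, the mean
  of the next one is \<open>S n / (2 n)\<close>. Hence \<open>E |S n|\<^sup>2 = n * harm n\<close>, and \<open>|S n|\<^sup>2 / n - harm n\<close>
  is a martingale, whose maximum up to time \<open>N\<close> exceeds a level \<open>c\<close> with probability at most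
  \<open>harm N / c\<close>. A Borel-Cantelli argument along \<open>N = 2 ^ 2 ^ j\<close> then gives
  \<open>|S n|\<^sup>2 = O(n (ln n)\<^sup>2)\<close> almost surely, which is the upper bound
  (\<open>AE_norm_walk_sq_upper\<close>).

  For the lower bound observe that, in the time scale \<open>t = ln n\<close>, the rescaled walk \<open>S n / sqrt n\<close>
  behaves like a planar Brownian motion, for which \<open>- ln |x|\<^sup>2\<close> is superharmonic. Accordingly
  \<open>ln n - ln (|S n|\<^sup>2 + n powr a + 36)\<close> with \<open>3 / 4 \<le> a < 1\<close> is a supermartingale up to errors
  with a summable mean (\<open>log_potential_drift\<close>, \<open>summable_mean_drift_error\<close>); the term
  \<open>n powr a\<close> removes the singularity at the origin, and only the third-order Taylor error forces
  \<open>a\<close> to exceed \<open>2 / 3\<close>. The negative part of this process has a mean of order \<open>ln (ln n)\<close> only,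
  because \<open>E |S n|\<^sup>2\<close> is of order \<open>n ln n\<close>. So the supermartingale maximal inequality bounds the
  probability that the process exceeds \<open>e * ln N\<close> before time \<open>N\<close> by a multiple of \<open>ln (ln N) / ln N\<close>, which is summable along
  \<open>N = 2 ^ 2 ^ j\<close>. Eventually \<open>|S n|\<^sup>2 + n powr a + 36 > n powr (1 - e)\<close>, and for
  \<open>1 - e > a\<close> this forces \<open>|S n|\<^sup>2 \<ge> n powr a\<close> (\<open>AE_norm_walk_sq_lower\<close>). Letting \<open>a\<close> tend to 1
  finishes the proof.

  Almost surely only finitely many histories of a given length are possible, so means are finite
  sums over histories (\<open>path_mean\<close>), and conditional expectations enter only through the
  recursion \<open>path_mean_Suc\<close>.
\<close>

section \<open>Unit steps and finite histories\<close>

lemma finite_unit_steps: "finite (unit_steps :: (real ^ 'd::finite) set)"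
  unfolding unit_steps_def by auto

lemma sum_unit_steps:
  fixes f :: "real ^ 'd::finite \<Rightarrow> 'b::comm_monoid_add"
  shows "(\<Sum>v\<in>unit_steps. f v) = (\<Sum>i\<in>UNIV. f (axis i 1) + f (- axis i 1))"
proof -
  have ne: "axis i 1 \<noteq> - axis j (1::real)" for i j :: 'd
  proof
    assume "axis i 1 = - axis j (1::real)"
    then have "axis i 1 $ i = (- axis j (1::real)) $ i" by simp
    then show False by (simp add: axis_def split: if_splits)
  qed
  have "(\<Sum>v\<in>unit_steps. f v) = (\<Sum>i\<in>UNIV. sum f {axis i 1, - axis i 1})"
    unfolding unit_steps_def
    by (rule sum.UNION_disjoint) (auto simp: ne ne[symmetric] axis_eq_axis)
  also have "\<dots> = (\<Sum>i\<in>UNIV. f (axis i 1) + f (- axis i 1))"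
    by (intro sum.cong refl) (simp add: ne)
  finally show ?thesis .
qed

lemma card_unit_steps: "card (unit_steps :: (real ^ 'd::finite) set) = 2 * CARD('d)"
  using sum_unit_steps[of "\<lambda>_::real ^ 'd. 1 :: nat"] by simp

lemma sum_unit_steps_eq_0: "(\<Sum>v\<in>unit_steps. v) = (0 :: real ^ 'd::finite)"
  by (simp add: sum_unit_steps)

lemma norm_unit_step: "v \<in> unit_steps \<Longrightarrow> norm (v :: real ^ 'd::finite) = 1"
  unfolding unit_steps_def by auto

definition histories :: "nat \<Rightarrow> (real ^ 'd::finite) list set" where
  "histories n = {l. length l = n \<and> set l \<subseteq> unit_steps}"

lemma finite_histories: "finite (histories n)"
  unfolding histories_def using finite_lists_length_eq[OF finite_unit_steps, of n]
  by (simp add: conj_commute)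

lemma sum_histories_Suc:
  fixes f :: "(real ^ 'd::finite) list \<Rightarrow> 'b::comm_monoid_add"
  shows "(\<Sum>l\<in>histories (Suc n). f l) = (\<Sum>l\<in>histories n. \<Sum>v\<in>unit_steps. f (v # l))"
proof -
  have "histories (Suc n) = (\<lambda>(l, v). v # l) ` (histories n \<times> (unit_steps :: (real ^ 'd) set))"
    unfolding histories_def by (force simp: length_Suc_conv)
  moreover have "inj_on (\<lambda>(l, v). v # l) (histories n \<times> (unit_steps :: (real ^ 'd) set))"
    by (auto simp: inj_on_def)
  ultimately show ?thesis
    by (simp add: sum.reindex sum.cartesian_product case_prod_unfold o_def)
qed

text \<open>
  The law of the next step once the uniformly chosen remembered index has been averaged out.
\<close>

definition step_prob :: "real \<Rightarrow> (real ^ 'd::finite) list \<Rightarrow> real ^ 'd \<Rightarrow> real" where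
  "step_prob p l v =
     (\<Sum>u\<leftarrow>l. if v = u then p else (1 - p) / (2 * real CARD('d) - 1)) / real (length l)"

text \<open>
  The step law is \<open>q\<close> times the counting measure on the unit steps plus \<open>p - q\<close> times the
  empirical law of the past. All conditional moments below come from this.
\<close>

lemma sum_step_prob:
  fixes f :: "real ^ 'd::finite \<Rightarrow> real" and p :: real
  assumes "set l \<subseteq> unit_steps" "l \<noteq> []"
  defines "q \<equiv> (1 - p) / (2 * real CARD('d) - 1)"
  shows "(\<Sum>v\<in>unit_steps. step_prob p l v * f v)
       = q * (\<Sum>v\<in>unit_steps. f v) + (p - q) / real (length l) * (\<Sum>u\<leftarrow>l. f u)"
proof -
  have *: "(\<Sum>v\<in>unit_steps. (\<Sum>u\<leftarrow>l. if v = u then p else q) * f v)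
      = real (length l) * q * (\<Sum>v\<in>unit_steps. f v) + (p - q) * (\<Sum>u\<leftarrow>l. f u)"
    using assms(1)
  proof (induction l)
    case (Cons u l)
    have "(\<Sum>v\<in>unit_steps. (if v = u then p else q) * f v)
        = (\<Sum>v\<in>unit_steps. q * f v + (if v = u then (p - q) * f v else 0))"
      by (intro sum.cong) (auto simp: algebra_simps)
    also have "\<dots> = q * (\<Sum>v\<in>unit_steps. f v) + (p - q) * f u"
      using Cons.prems by (simp add: sum.distrib sum_distrib_left[symmetric] sum.delta finite_unit_steps)
    finally have "(\<Sum>v\<in>unit_steps. (if v = u then p else q) * f v)
        = q * (\<Sum>v\<in>unit_steps. f v) + (p - q) * f u" .
    moreover have "(\<Sum>v\<in>unit_steps. (\<Sum>u\<leftarrow>l. if v = u then p else q) * f v)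
        = real (length l) * q * (\<Sum>v\<in>unit_steps. f v) + (p - q) * (\<Sum>u\<leftarrow>l. f u)"
      using Cons by simp
    ultimately show ?case
      by (simp only: list.map sum_list.Cons distrib_right sum.distrib) (simp add: algebra_simps)
  qed simp
  have "(\<Sum>v\<in>unit_steps. step_prob p l v * f v)
      = (\<Sum>v\<in>unit_steps. (\<Sum>u\<leftarrow>l. if v = u then p else q) * f v) / real (length l)"
    unfolding step_prob_def q_def by (simp add: sum_divide_distrib)
  then show ?thesis using assms(2) unfolding * by (simp add: field_simps)
qed

lemma step_prob_nonneg:
  assumes "0 \<le> p" "p \<le> 1"
  shows "0 \<le> step_prob p l (v :: real ^ 'd::finite)"
proof -
  have "1 \<le> real CARD('d)" by (simp add: Suc_leI)
  then have "0 \<le> 2 * real CARD('d) - 1" by linarith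
  then have "0 \<le> (1 - p) / (2 * real CARD('d) - 1)"
    using assms(2) by (intro divide_nonneg_nonneg) linarith+
  then show ?thesis unfolding step_prob_def
    using assms(1) by (intro divide_nonneg_nonneg sum_list_nonneg) auto
qed

lemma sum_step_prob_eq_1:
  assumes "set l \<subseteq> unit_steps" "l \<noteq> []"
  shows "(\<Sum>v\<in>unit_steps. step_prob p l (v :: real ^ 'd::finite)) = 1"
proof -
  define m where "m = 2 * real CARD('d) - 1"
  have "1 \<le> real CARD('d)" by (simp add: Suc_leI)
  then have m: "0 < m" unfolding m_def by linarith
  have "(\<Sum>v\<in>unit_steps. step_prob p l v) = (1 - p) / m * (m + 1) + (p - (1 - p) / m)"
    using sum_step_prob[OF assms, of p "\<lambda>_. 1"] assms(2)
    by (simp add: card_unit_steps sum_list_triv m_def)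
  also have "\<dots> = 1" using m by (simp add: field_simps)
  finally show ?thesis .
qed

section \<open>The law of the path\<close>

text \<open>Histories list the most recent step first, so that one step of the walk is one \<open>Cons\<close>.\<close>

primrec history :: "(nat \<Rightarrow> 'a \<Rightarrow> 'b) \<Rightarrow> nat \<Rightarrow> 'a \<Rightarrow> 'b list" where
  "history \<sigma> 0 \<omega> = []"
| "history \<sigma> (Suc n) \<omega> = \<sigma> (Suc n) \<omega> # history \<sigma> n \<omega>"

lemma length_history [simp]: "length (history \<sigma> n \<omega>) = n"
  by (induction n) auto

context merw
begin

lemma history_event_past:
  "{\<omega> \<in> space M. history \<sigma> n \<omega> = l} \<in> sets (past M \<sigma> K n)"
proof -
  have gen: "past_gen M \<sigma> K n \<subseteq> Pow (space M)"
    unfolding past_gen_def by (auto dest!: sets.sets_into_space)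
  have sp: "space (past M \<sigma> K n) = space M"
    unfolding past_def using gen by (simp add: space_measure_of)
  have step: "{\<omega> \<in> space M. \<sigma> i \<omega> = v} \<in> sets (past M \<sigma> K n)" if "1 \<le> i" "i \<le> n" for i v
  proof -
    have "\<sigma> i -` {v} \<inter> space M \<in> past_gen M \<sigma> K n"
      unfolding past_gen_def using that in_vimage_algebra[of "{v}" borel "\<sigma> i" "space M"] by auto
    then have "\<sigma> i -` {v} \<inter> space M \<in> sets (past M \<sigma> K n)"
      unfolding past_def using gen by (simp add: sets_measure_of)
    moreover have "\<sigma> i -` {v} \<inter> space M = {\<omega> \<in> space M. \<sigma> i \<omega> = v}" by auto
    ultimately show ?thesis by simp
  qed
  have "{\<omega> \<in> space M. history \<sigma> k \<omega> = l} \<in> sets (past M \<sigma> K n)" if "k \<le> n" for k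
    using that
  proof (induction k arbitrary: l)
    case 0
    show ?case using sets.top[of "past M \<sigma> K n"] sp by (cases "l = []") auto
  next
    case (Suc k)
    show ?case
    proof (cases l)
      case (Cons v l')
      have "{\<omega> \<in> space M. history \<sigma> (Suc k) \<omega> = l}
          = {\<omega> \<in> space M. \<sigma> (Suc k) \<omega> = v} \<inter> {\<omega> \<in> space M. history \<sigma> k \<omega> = l'}"
        using Cons by auto
      then show ?thesis using Suc step[of "Suc k" v] by auto
    qed simp
  qed
  then show ?thesis by simp
qed

lemma past_mem_subalgebra:
  assumes "n \<ge> 1"
  shows "subalgebra M (past_mem M \<sigma> K n)"
    and "sets (past M \<sigma> K n) \<subseteq> sets (past_mem M \<sigma> K n)"
    and "{\<omega> \<in> space M. K n \<omega> = j} \<in> sets (past_mem M \<sigma> K n)"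
    and "{\<omega> \<in> space M. K n \<omega> = j} \<in> sets (vimage_algebra (space M) (K n) (count_space UNIV))"
proof -
  let ?V = "sets (vimage_algebra (space M) (K n) (count_space UNIV))"
  have sig: "sets (vimage_algebra (space M) (\<sigma> i) borel) \<subseteq> sets M" if "1 \<le> i" for i
    using measurable_step[OF that] by (auto simp: sets_vimage_algebra intro!: sets.sigma_sets_subset)
  have ind: "sets (vimage_algebra (space M) (K i) (count_space UNIV)) \<subseteq> sets M" if "1 \<le> i" for i
    using measurable_index[OF that] by (auto simp: sets_vimage_algebra intro!: sets.sigma_sets_subset)
  have sub: "past_gen M \<sigma> K n \<union> ?V \<subseteq> sets M"
    using sig ind assms unfolding past_gen_def by fastforce
  then have pow: "past_gen M \<sigma> K n \<union> ?V \<subseteq> Pow (space M)"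
    using sets.space_closed by blast
  show "subalgebra M (past_mem M \<sigma> K n)"
    unfolding subalgebra_def past_mem_def using pow sub
    by (simp add: space_measure_of sets_measure_of sets.sigma_sets_subset)
  show "sets (past M \<sigma> K n) \<subseteq> sets (past_mem M \<sigma> K n)"
    unfolding past_def past_mem_def using pow
    by (simp add: sets_measure_of) (rule sigma_sets_mono', auto)
  have "K n -` {j} \<inter> space M = {\<omega> \<in> space M. K n \<omega> = j}" by auto
  then show V: "{\<omega> \<in> space M. K n \<omega> = j} \<in> ?V"
    using in_vimage_algebra[of "{j}" "count_space UNIV" "K n" "space M"] by simp
  then show "{\<omega> \<in> space M. K n \<omega> = j} \<in> sets (past_mem M \<sigma> K n)"
    unfolding past_mem_def using pow by (simp add: sets_measure_of)
qed

lemma history_event [measurable]: "{\<omega> \<in> space M. history \<sigma> n \<omega> = l} \<in> events"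
proof (cases "n = 0")
  case True then show ?thesis by (cases "l = []") auto
next
  case False
  then show ?thesis
    using history_event_past[of n l] past_mem_subalgebra(1,2)[of n]
    unfolding subalgebra_def by auto
qed

text \<open>
  On the event that the first \<open>n\<close> steps form \<open>l\<close>, the conditional law of the next step is a function of
  the index \<open>K n\<close> alone; since \<open>K n\<close> is uniform and independent of that event, integrating over
  it yields the average over the entries of \<open>l\<close>.
\<close>

lemma prob_history_Suc:
  assumes "n \<ge> 1" "v \<in> unit_steps"
  shows "prob {\<omega> \<in> space M. history \<sigma> (Suc n) \<omega> = v # l}
       = prob {\<omega> \<in> space M. history \<sigma> n \<omega> = l} * step_prob p l v"
proof (cases "length l = n")
  case False
  then have "{\<omega> \<in> space M. history \<sigma> n \<omega> = l} = {}" "{\<omega> \<in> space M. history \<sigma> (Suc n) \<omega> = v # l} = {}"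
    by auto
  then show ?thesis by (simp only: measure_empty mult_zero_left)
next
  case True
  define c where "c = (\<lambda>u. if v = u then p else (1 - p) / (2 * real CARD('d) - 1))"
  define B where "B = {\<omega> \<in> space M. history \<sigma> n \<omega> = l}"
  define E where "E = {\<omega> \<in> space M. \<sigma> (Suc n) \<omega> = v}"
  define Kj where "Kj = (\<lambda>j. {\<omega> \<in> space M. K n \<omega> = j})"
  define F where "F = past_mem M \<sigma> K n"
  note sub = past_mem_subalgebra[OF assms(1)]
  interpret F: finite_measure_subalgebra M F
    unfolding finite_measure_subalgebra_def finite_measure_subalgebra_axioms_def F_def
    by (intro conjI finite_measure_axioms sub(1))
  have B_F: "B \<in> sets F" and B_past: "B \<in> sets (past M \<sigma> K n)"
    unfolding B_def F_def using subsetD[OF sub(2) history_event_past] history_event_past .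
  have B_M [measurable]: "B \<in> events" unfolding B_def by (rule history_event)
  have [measurable]: "Kj j \<in> events" for j
    using sub(1) sub(3)[of j] unfolding Kj_def subalgebra_def by (blast intro: subsetD)
  have E_M [measurable]: "E \<in> events"
    using measurable_sets[OF measurable_step[of "Suc n"], of "{v}"] unfolding E_def
    by (simp add: vimage_def Int_def conj_commute)
  \<comment> \<open>Uniformity and independence of the remembered index.\<close>
  have prob_Kj: "prob (B \<inter> Kj j) = prob B * (1 / real n)" if "j \<in> {1..n}" for j
  proof -
    have "prob (Kj j) = measure (distr M (count_space UNIV) (K n)) {j}"
      using measurable_index[OF assms(1)]
      by (subst measure_distr) (auto simp: Kj_def intro!: arg_cong[where f = prob])
    also have "\<dots> = 1 / real n"
      using index_uniform[OF assms(1)] that by (simp add: measure_pmf_single pmf_of_set)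
    finally show ?thesis
      using indep_setD[OF index_indep[OF assms(1)] B_past sub(4)[of j]] unfolding Kj_def by simp
  qed
  have K_range: "AE \<omega> in M. K n \<omega> \<in> {1..n}"
  proof -
    have "AE k in distr M (count_space UNIV) (K n). k \<in> {1..n}"
      unfolding index_uniform[OF assms(1)] using assms(1) by (auto simp: AE_measure_pmf_iff)
    then show ?thesis using measurable_index[OF assms(1)] by (subst (asm) AE_distr_iff) auto
  qed
  have "prob {\<omega> \<in> space M. history \<sigma> (Suc n) \<omega> = v # l} = prob (B \<inter> E)"
    by (rule arg_cong[where f = prob]) (auto simp: B_def E_def)
  also have "\<dots> = (\<integral>\<omega>. indicator B \<omega> * indicator E \<omega> \<partial>M)"
    by (simp add: indicator_inter_arith[symmetric])
  also have "\<dots> = (\<integral>\<omega>. indicator B \<omega> * real_cond_exp M F (indicator E) \<omega> \<partial>M)"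
    using B_F by (intro F.real_cond_exp_intg(2)[symmetric])
      (auto simp: indicator_inter_arith[symmetric] less_top[symmetric])
  \<comment> \<open>Histories are reversed in time, so the step with index \<open>j\<close> is entry \<open>j - 1\<close> of \<open>rev l\<close>.\<close>
  also have "\<dots> = (\<integral>\<omega>. (\<Sum>j=1..n. indicator (B \<inter> Kj j) \<omega> * c (rev l ! (j - 1))) \<partial>M)"
  proof (rule integral_cong_AE)
    have law: "AE \<omega> in M. real_cond_exp M F (indicator E) \<omega> = c (\<sigma> (K n \<omega>) \<omega>)"
      using step_law[OF assms] unfolding E_def F_def c_def .
    have nth: "rev (history \<sigma> m \<omega>) ! (j - 1) = \<sigma> j \<omega>" if "1 \<le> j" "j \<le> m" for j m \<omega>
      using that
    proof (induction m)
      case (Suc m)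
      then show ?case by (cases "j = Suc m") (auto simp: nth_append)
    qed simp
    show "AE \<omega> in M. indicator B \<omega> * real_cond_exp M F (indicator E) \<omega>
        = (\<Sum>j=1..n. indicator (B \<inter> Kj j) \<omega> * c (rev l ! (j - 1)))"
      using law K_range
    proof eventually_elim
      case (elim \<omega>)
      show ?case
      proof (cases "\<omega> \<in> B")
        case True
        then have w: "\<omega> \<in> space M" and l: "l = history \<sigma> n \<omega>" by (auto simp: B_def)
        have "(\<Sum>j=1..n. indicator (B \<inter> Kj j) \<omega> * c (rev l ! (j - 1)))
            = (\<Sum>j=1..n. if j = K n \<omega> then c (rev l ! (j - 1)) else 0)"
          using True w by (intro sum.cong) (auto simp: Kj_def indicator_def)
        also have "\<dots> = c (\<sigma> (K n \<omega>) \<omega>)"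
          using elim(2) nth[of "K n \<omega>" n \<omega>] l by (simp add: sum.delta)
        finally show ?thesis using True elim by simp
      qed simp
    qed
  qed (use B_M in measurable)
  also have "\<dots> = (\<Sum>j=1..n. prob (B \<inter> Kj j) * c (rev l ! (j - 1)))"
    by (subst Bochner_Integration.integral_sum)
      (auto simp: less_top[symmetric] intro!: integrable_real_mult_indicator)
  also have "\<dots> = prob B * ((\<Sum>j=1..n. c (rev l ! (j - 1))) / real n)"
    by (simp add: prob_Kj sum_distrib_left sum_divide_distrib)
  also have "(\<Sum>j=1..n. c (rev l ! (j - 1))) = (\<Sum>u\<leftarrow>l. c u)"
  proof -
    have "(\<Sum>j=1..n. c (rev l ! (j - 1))) = (\<Sum>i<n. c (rev l ! i))"
      by (rule sum.reindex_bij_witness[of _ Suc "\<lambda>j. j - 1"]) auto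
    also have "\<dots> = (\<Sum>u\<leftarrow>rev l. c u)"
      using True by (simp add: sum_list_sum_nth atLeast0LessThan)
    also have "\<dots> = (\<Sum>u\<leftarrow>l. c u)" by (simp add: rev_map[symmetric] sum_list.rev)
    finally show ?thesis .
  qed
  also have "(\<Sum>u\<leftarrow>l. c u) / real n = step_prob p l v"
    unfolding step_prob_def c_def True[symmetric] by simp
  finally show ?thesis unfolding B_def .
qed

text \<open>
  The expectation of \<open>h\<close> at the history of the first \<open>n\<close> steps. It is a finite sum rather than an
  integral because \<open>h\<close> ranges over all functions of lists, measurable or not.
\<close>

definition path_mean :: "nat \<Rightarrow> ((real, 'd) vec list \<Rightarrow> real) \<Rightarrow> real" where
  "path_mean n h = (\<Sum>l\<in>histories n. prob {\<omega> \<in> space M. history \<sigma> n \<omega> = l} * h l)"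

lemma path_mean_Suc:
  assumes "n \<ge> 1"
  shows "path_mean (Suc n) h = path_mean n (\<lambda>l. \<Sum>v\<in>unit_steps. step_prob p l v * h (v # l))"
  unfolding path_mean_def sum_histories_Suc sum_distrib_left
  by (intro sum.cong refl) (simp add: prob_history_Suc[OF assms] mult.assoc del: history.simps)

lemma path_mean_1: "path_mean 1 h = h [axis 1 1]"
proof -
  have "prob {\<omega> \<in> space M. history \<sigma> 1 \<omega> = l} = (if l = [axis 1 1] then 1 else 0)" for l
  proof -
    have "{\<omega> \<in> space M. history \<sigma> 1 \<omega> = l} = (if l = [axis 1 1] then space M else {})"
      using first_step by auto
    then show ?thesis by (simp add: prob_space)
  qed
  moreover have "[axis (1 :: 'd) 1] \<in> histories 1"
    by (auto simp: histories_def unit_steps_def)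
  ultimately show ?thesis
    unfolding path_mean_def by (simp add: if_distrib[of "\<lambda>x. x * _"] finite_histories sum.delta
        del: One_nat_def history.simps cong: if_cong)
qed

lemma path_mean_mono:
  "(\<And>l. l \<in> histories n \<Longrightarrow> f l \<le> g l) \<Longrightarrow> path_mean n f \<le> path_mean n g"
  unfolding path_mean_def by (intro sum_mono mult_left_mono) auto

lemma path_mean_cong:
  "(\<And>l. l \<in> histories n \<Longrightarrow> f l = g l) \<Longrightarrow> path_mean n f = path_mean n g"
  unfolding path_mean_def by (intro sum.cong) auto

lemma path_mean_add: "path_mean n (\<lambda>l. f l + g l) = path_mean n f + path_mean n g"
  unfolding path_mean_def by (simp add: distrib_left sum.distrib)

lemma path_mean_cmult: "path_mean n (\<lambda>l. c * f l) = c * path_mean n f"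
  unfolding path_mean_def by (simp add: sum_distrib_left mult.left_commute)

lemma path_mean_const:
  assumes "n \<ge> 1"
  shows "path_mean n (\<lambda>_. c) = c"
  using assms
proof (induction n rule: dec_induct)
  case base
  show ?case using path_mean_1[of "\<lambda>_. c"] by simp
next
  case (step n)
  have "path_mean (Suc n) (\<lambda>_. c) = path_mean n (\<lambda>l. \<Sum>v\<in>unit_steps. step_prob p l v * c)"
    using step(1) by (rule path_mean_Suc)
  also have "\<dots> = path_mean n (\<lambda>_. c)"
  proof (rule path_mean_cong)
    fix l :: "(real, 'd) vec list" assume "l \<in> histories n"
    then have "set l \<subseteq> unit_steps" "l \<noteq> []" using step(1) by (auto simp: histories_def)
    from sum_step_prob_eq_1[OF this, of p]
    show "(\<Sum>v\<in>unit_steps. step_prob p l v * c) = c" by (simp add: sum_distrib_right[symmetric])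
  qed
  finally show ?case using step.IH by simp
qed

text \<open>
  The law of the steps is only given almost everywhere, so a step may fail to be a unit vector on a
  null set. The masses of the histories made of unit steps sum to 1, by \<open>path_mean_const\<close>.
\<close>

lemma AE_history_in_histories: "AE \<omega> in M. history \<sigma> n \<omega> \<in> histories n"
proof (cases "n \<ge> 1")
  case True
  have eq: "{\<omega> \<in> space M. history \<sigma> n \<omega> \<in> histories n}
      = (\<Union>l\<in>histories n. {\<omega> \<in> space M. history \<sigma> n \<omega> = l})" by auto
  have "prob {\<omega> \<in> space M. history \<sigma> n \<omega> \<in> histories n}
      = (\<Sum>l\<in>histories n. prob {\<omega> \<in> space M. history \<sigma> n \<omega> = l})"
    unfolding eq
    by (rule finite_measure_finite_Union) (auto simp: finite_histories disjoint_family_on_def)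
  also have "\<dots> = 1" using path_mean_const[OF True, of 1] by (simp add: path_mean_def)
  finally have "prob {\<omega> \<in> space M. history \<sigma> n \<omega> \<in> histories n} = 1" .
  then show ?thesis by (subst (asm) prob_Collect_eq_1) (auto simp: eq finite_histories)
next
  case False
  then have "n = 0" by simp
  then show ?thesis by (simp add: histories_def)
qed

text \<open>
  Markov's inequality. The event is a finite union of events fixing the history, hence measurable
  for every predicate \<open>Q\<close>.
\<close>

lemma prob_history_le:
  assumes nonneg: "\<And>l. l \<in> histories n \<Longrightarrow> 0 \<le> h l"
    and hit: "\<And>l. l \<in> histories n \<Longrightarrow> Q l \<Longrightarrow> 1 \<le> h l"
  shows "{\<omega> \<in> space M. history \<sigma> n \<omega> \<in> histories n \<and> Q (history \<sigma> n \<omega>)} \<in> events"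
    and "prob {\<omega> \<in> space M. history \<sigma> n \<omega> \<in> histories n \<and> Q (history \<sigma> n \<omega>)} \<le> path_mean n h"
proof -
  let ?H = "{l \<in> histories n. Q l}"
  have eq: "{\<omega> \<in> space M. history \<sigma> n \<omega> \<in> histories n \<and> Q (history \<sigma> n \<omega>)}
      = (\<Union>l\<in>?H. {\<omega> \<in> space M. history \<sigma> n \<omega> = l})" by auto
  have fin: "finite ?H" by (rule finite_subset[OF _ finite_histories[of n]]) auto
  show "{\<omega> \<in> space M. history \<sigma> n \<omega> \<in> histories n \<and> Q (history \<sigma> n \<omega>)} \<in> events"
    unfolding eq using fin by auto
  have "prob {\<omega> \<in> space M. history \<sigma> n \<omega> \<in> histories n \<and> Q (history \<sigma> n \<omega>)}
      = (\<Sum>l\<in>?H. prob {\<omega> \<in> space M. history \<sigma> n \<omega> = l})"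
    unfolding eq by (rule finite_measure_finite_Union) (auto simp: fin disjoint_family_on_def)
  also have "\<dots> \<le> (\<Sum>l\<in>?H. prob {\<omega> \<in> space M. history \<sigma> n \<omega> = l} * h l)"
  proof (intro sum_mono)
    fix l assume "l \<in> ?H"
    then have "1 \<le> h l" using hit by simp
    then show "prob {\<omega> \<in> space M. history \<sigma> n \<omega> = l} \<le> prob {\<omega> \<in> space M. history \<sigma> n \<omega> = l} * h l"
      using mult_left_mono[of 1 "h l" "prob {\<omega> \<in> space M. history \<sigma> n \<omega> = l}"] by simp
  qed
  also have "\<dots> \<le> path_mean n h"
    unfolding path_mean_def using nonneg by (intro sum_mono2) (auto simp: finite_histories)
  finally show "prob {\<omega> \<in> space M. history \<sigma> n \<omega> \<in> histories n \<and> Q (history \<sigma> n \<omega>)} \<le> path_mean n h" .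
qed

end

section \<open>A maximal inequality\<close>

text \<open>
  The process \<open>W\<close> stopped when it first reaches the level \<open>c\<close>. The empty history gets the value 0,
  which lies below any positive level, so stopping is possible from the first step on.
\<close>

context
  fixes W :: "'b list \<Rightarrow> real" and c :: real
begin

fun frozen :: "'b list \<Rightarrow> real" where
  "frozen [] = 0"
| "frozen (v # l) = (if c \<le> frozen l then frozen l else W (v # l))"

lemma frozen_cases: "l \<noteq> [] \<Longrightarrow> c \<le> frozen l \<or> frozen l = W l"
  by (cases l) auto

lemma level_le_frozen:
  assumes "k \<in> {1..n}" "c \<le> W (history \<sigma> k \<omega>)"
  shows "c \<le> frozen (history \<sigma> n \<omega>)"
  using assms
proof (induction n)
  case (Suc n)
  show ?case
  proof (cases "k = Suc n")
    case True
    then show ?thesis using Suc.prems by simp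
  next
    case False
    then have "c \<le> frozen (history \<sigma> n \<omega>)" using Suc by auto
    then show ?thesis by simp
  qed
qed simp

end

context merw
begin

text \<open>
  Doob's inequality for a supermartingale up to errors \<open>g\<close>. Freezing \<open>W\<close> at the level \<open>c\<close>
  keeps the drift bound, so the mean of the frozen process grows by at most that of \<open>g\<close> in each step.
  At time \<open>N\<close> the frozen process is at least \<open>c\<close> if the level was reached and equals \<open>W\<close> otherwise;
  adding the negative part of \<open>W\<close> makes it nonnegative, and Markov's inequality applies.
  The event is covered by a measurable \<open>A\<close> because \<open>W\<close> need not be measurable on the null set
  of impossible histories.
\<close>

lemma maximal_inequality:
  assumes N: "N \<ge> 1" and c: "c > 0"
    and g: "\<And>l. 0 \<le> g l"
    and drift: "\<And>l. l \<noteq> [] \<Longrightarrow> set l \<subseteq> unit_steps \<Longrightarrow>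
        (\<Sum>v\<in>unit_steps. step_prob p l v * W (v # l)) \<le> W l + g l"
  shows "\<exists>A\<in>events. prob A \<le>
        (W [axis 1 1] + (\<Sum>k=1..<N. path_mean k g) + path_mean N (\<lambda>l. max 0 (- W l))) / c
      \<and> (AE \<omega> in M. (\<exists>k\<in>{1..N}. c \<le> W (history \<sigma> k \<omega>)) \<longrightarrow> \<omega> \<in> A)"
proof -
  let ?F = "frozen W c"
  have mean: "path_mean n ?F \<le> W [axis 1 1] + (\<Sum>k=1..<n. path_mean k g)" if "n \<ge> 1" for n
    using that
  proof (induction n rule: dec_induct)
    case base
    show ?case using path_mean_1[of ?F] c by simp
  next
    case (step n)
    have "path_mean (Suc n) ?F = path_mean n (\<lambda>l. \<Sum>v\<in>unit_steps. step_prob p l v * ?F (v # l))"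
      using step(1) by (rule path_mean_Suc)
    also have "\<dots> \<le> path_mean n (\<lambda>l. ?F l + g l)"
    proof (rule path_mean_mono)
      fix l :: "(real, 'd) vec list" assume "l \<in> histories n"
      then have l: "set l \<subseteq> unit_steps" "l \<noteq> []" using step(1) by (auto simp: histories_def)
      show "(\<Sum>v\<in>unit_steps. step_prob p l v * ?F (v # l)) \<le> ?F l + g l"
      proof (cases "c \<le> ?F l")
        case True
        then show ?thesis
          using sum_step_prob_eq_1[OF l, of p] g[of l] by (simp add: sum_distrib_right[symmetric])
      next
        case False
        then have "?F l = W l" using frozen_cases[OF l(2), of c W] by simp
        then show ?thesis using False drift[OF l(2,1)] by simp
      qed
    qed
    also have "\<dots> = path_mean n ?F + path_mean n g" by (rule path_mean_add)
    finally show ?case using step by simp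
  qed
  let ?Q = "\<lambda>l. c \<le> ?F l"
  let ?A = "{\<omega> \<in> space M. history \<sigma> N \<omega> \<in> histories N \<and> ?Q (history \<sigma> N \<omega>)}"
  let ?h = "\<lambda>l. (1 / c) * (?F l + max 0 (- W l))"
  have h0: "0 \<le> ?h l" if "l \<in> histories N" for l
  proof -
    have "l \<noteq> []" using that N by (auto simp: histories_def)
    from frozen_cases[OF this, of c W] have "0 \<le> ?F l + max 0 (- W l)"
      using c by (auto simp: max_def)
    then show ?thesis using c by simp
  qed
  have h1: "1 \<le> ?h l" if "?Q l" for l
    using that c by (simp add: field_simps)
  have "prob ?A \<le> path_mean N ?h" by (rule prob_history_le(2)[OF h0 h1])
  also have "\<dots> = (path_mean N ?F + path_mean N (\<lambda>l. max 0 (- W l))) / c"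
    by (simp only: path_mean_cmult path_mean_add) simp
  also have "\<dots> \<le> (W [axis 1 1] + (\<Sum>k=1..<N. path_mean k g)
      + path_mean N (\<lambda>l. max 0 (- W l))) / c"
    using mean[OF N] c by (intro divide_right_mono) auto
  finally have "prob ?A \<le> \<dots>" .
  moreover have "AE \<omega> in M. (\<exists>k\<in>{1..N}. c \<le> W (history \<sigma> k \<omega>)) \<longrightarrow> \<omega> \<in> ?A"
    using AE_history_in_histories[of N] AE_space
  proof eventually_elim
    case (elim \<omega>)
    then show ?case using level_le_frozen[of _ N c W \<sigma> \<omega>] by auto
  qed
  moreover have "?A \<in> events" by (rule prob_history_le(1)[OF h0 h1])
  ultimately show ?thesis by blast
qed

text \<open>
  The form of the first Borel-Cantelli lemma used for both bounds: \<open>N j\<close> is the end of the \<open>j\<close>-th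
  stage, \<open>c j\<close> the level that should not be reached before it, and \<open>b j / c j\<close> the bound from
  \<open>maximal_inequality\<close>.
\<close>

lemma eventually_below_level:
  fixes N :: "nat \<Rightarrow> nat" and c b :: "nat \<Rightarrow> real"
  assumes N: "\<And>j. N j \<ge> 1" and c: "\<And>j. c j > 0"
    and g: "\<And>l. 0 \<le> g l"
    and drift: "\<And>l. l \<noteq> [] \<Longrightarrow> set l \<subseteq> unit_steps \<Longrightarrow>
        (\<Sum>v\<in>unit_steps. step_prob p l v * W (v # l)) \<le> W l + g l"
    and bound: "\<And>j. W [axis 1 1] + (\<Sum>k=1..<N j. path_mean k g)
        + path_mean (N j) (\<lambda>l. max 0 (- W l)) \<le> b j"
    and summable: "summable (\<lambda>j. b j / c j)"
  shows "AE \<omega> in M. eventually (\<lambda>j. \<forall>k\<in>{1..N j}. W (history \<sigma> k \<omega>) < c j) sequentially"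
proof -
  have "\<exists>A. A \<in> events \<and> prob A \<le> b j / c j
      \<and> (AE \<omega> in M. (\<exists>k\<in>{1..N j}. c j \<le> W (history \<sigma> k \<omega>)) \<longrightarrow> \<omega> \<in> A)" for j
  proof -
    obtain A where "A \<in> events"
      "prob A \<le> (W [axis 1 1] + (\<Sum>k=1..<N j. path_mean k g)
        + path_mean (N j) (\<lambda>l. max 0 (- W l))) / c j"
      "AE \<omega> in M. (\<exists>k\<in>{1..N j}. c j \<le> W (history \<sigma> k \<omega>)) \<longrightarrow> \<omega> \<in> A"
      using maximal_inequality[OF N[of j] c[of j] g drift] by blast
    moreover note divide_right_mono[OF bound[of j] less_imp_le[OF c[of j]]]
    ultimately show ?thesis by (intro exI[of _ A] conjI) (auto elim: order_trans)
  qed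
  from choice[OF allI[OF this]] obtain A
    where "\<forall>j. A j \<in> events \<and> prob (A j) \<le> b j / c j
      \<and> (AE \<omega> in M. (\<exists>k\<in>{1..N j}. c j \<le> W (history \<sigma> k \<omega>)) \<longrightarrow> \<omega> \<in> A j)" ..
  then have A: "\<And>j. A j \<in> events" "\<And>j. prob (A j) \<le> b j / c j"
    and sub: "\<And>j. AE \<omega> in M. (\<exists>k\<in>{1..N j}. c j \<le> W (history \<sigma> k \<omega>)) \<longrightarrow> \<omega> \<in> A j"
    by simp_all
  have "summable (\<lambda>j. prob (A j))"
    by (rule summable_comparison_test'[OF summable, of 0]) (simp add: A(2))
  then have "AE \<omega> in M. eventually (\<lambda>j. \<omega> \<in> space M - A j) sequentially"
    using A(1) by (intro borel_cantelli_AE1) (auto simp: less_top[symmetric])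
  moreover have "AE \<omega> in M. \<forall>j. (\<exists>k\<in>{1..N j}. c j \<le> W (history \<sigma> k \<omega>)) \<longrightarrow> \<omega> \<in> A j"
    unfolding AE_all_countable using sub by (rule allI)
  ultimately show ?thesis
  proof eventually_elim
    case (elim \<omega>)
    from elim(1) show ?case
      by (rule eventually_mono) (use elim(2) in \<open>force simp: not_le\<close>)
  qed
qed

text \<open>
  The assumption \<open>memory\<close> is criticality: it makes the conditional mean increment of the centred
  additive functional \<open>F = (\<Sum>u\<leftarrow>l. f u)\<close> equal to \<open>F / (2 n)\<close>. Its square therefore gains the factor
  \<open>1 + 1 / n\<close>, which balances a normalisation by \<open>n\<close> exactly and leaves a harmonic sum. The case
  \<open>f v = v\<close> is the walk itself; in the plane, \<open>f v = (v $ 1)\<^sup>2 - (v $ 2)\<^sup>2\<close> is the imbalance between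
  horizontal and vertical steps.
\<close>

lemma step_mean_norm_sum_sq:
  fixes f :: "(real, 'd) vec \<Rightarrow> 'b::real_inner"
  assumes centred: "(\<Sum>v\<in>unit_steps. f v) = 0"
    and unit: "\<And>v. v \<in> unit_steps \<Longrightarrow> norm (f v) = 1"
    and memory: "p - (1 - p) / (2 * real CARD('d) - 1) = 1 / 2"
    and l: "set l \<subseteq> unit_steps" "l \<noteq> []"
  shows "(\<Sum>v\<in>unit_steps. step_prob p l v * (norm (\<Sum>u\<leftarrow>v # l. f u))\<^sup>2)
       = (1 + 1 / real (length l)) * (norm (\<Sum>u\<leftarrow>l. f u))\<^sup>2 + 1"
proof -
  let ?G = "\<lambda>l. (norm (\<Sum>u\<leftarrow>l. f u))\<^sup>2"
  define F where "F = (\<Sum>u\<leftarrow>l. f u)"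
  have "(\<Sum>v\<in>unit_steps. step_prob p l v * ?G (v # l))
      = (\<Sum>v\<in>unit_steps. step_prob p l v * (f v \<bullet> F) * 2 + step_prob p l v * (?G l + 1))"
  proof (rule sum.cong[OF refl])
    fix v :: "(real, 'd) vec" assume "v \<in> unit_steps"
    then have "f v \<bullet> f v = 1" using unit by (simp add: dot_square_norm)
    then have "?G (v # l) = 2 * (f v \<bullet> F) + (?G l + 1)"
      by (simp add: F_def power2_norm_eq_inner inner_add_left inner_add_right inner_commute)
    then show "step_prob p l v * ?G (v # l)
        = step_prob p l v * (f v \<bullet> F) * 2 + step_prob p l v * (?G l + 1)"
      by (simp add: algebra_simps)
  qed
  also have "\<dots> = (\<Sum>v\<in>unit_steps. step_prob p l v * (f v \<bullet> F)) * 2 + (?G l + 1)"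
    using sum_step_prob_eq_1[OF l, of p]
    by (simp only: sum.distrib sum_distrib_right[symmetric] mult_1_left)
  also have "(\<Sum>v\<in>unit_steps. step_prob p l v * (f v \<bullet> F)) = ?G l / (2 * real (length l))"
  proof -
    have "(\<Sum>u\<leftarrow>l. f u \<bullet> F) = (\<Sum>u\<leftarrow>l. f u) \<bullet> F" by (induction l) (auto simp: inner_add_left)
    then have s: "(\<Sum>u\<leftarrow>l. f u \<bullet> F) = ?G l" by (simp add: F_def power2_norm_eq_inner)
    have "(\<Sum>v\<in>unit_steps. f v \<bullet> F) = 0"
      using centred by (simp add: inner_sum_left[symmetric])
    then show ?thesis
      using sum_step_prob[OF l, of p "\<lambda>v. f v \<bullet> F"] by (simp add: memory s)
  qed
  finally show ?thesis by (simp add: algebra_simps)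
qed

lemma path_mean_norm_sum_sq:
  fixes f :: "(real, 'd) vec \<Rightarrow> 'b::real_inner"
  assumes centred: "(\<Sum>v\<in>unit_steps. f v) = 0"
    and unit: "\<And>v. v \<in> unit_steps \<Longrightarrow> norm (f v) = 1"
    and memory: "p - (1 - p) / (2 * real CARD('d) - 1) = 1 / 2"
    and n: "n \<ge> 1"
  shows "path_mean n (\<lambda>l. (norm (\<Sum>u\<leftarrow>l. f u))\<^sup>2) = real n * harm n"
  using n
proof (induction n rule: dec_induct)
  case base
  have "axis (1 :: 'd) 1 \<in> unit_steps" by (auto simp: unit_steps_def)
  then show ?case using path_mean_1[of "\<lambda>l. (norm (\<Sum>u\<leftarrow>l. f u))\<^sup>2"] unit
    by (simp add: harm_expand)
next
  case (step n)
  let ?G = "\<lambda>l. (norm (\<Sum>u\<leftarrow>l. f u))\<^sup>2"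
  have "path_mean (Suc n) ?G
      = path_mean n (\<lambda>l. \<Sum>v\<in>unit_steps. step_prob p l v * ?G (v # l))"
    using step(1) by (rule path_mean_Suc)
  also have "\<dots> = path_mean n (\<lambda>l. (1 + 1 / real n) * ?G l + 1)"
  proof (rule path_mean_cong)
    fix l :: "(real, 'd) vec list" assume "l \<in> histories n"
    then have "set l \<subseteq> unit_steps" "l \<noteq> []" "length l = n"
      using step(1) by (auto simp: histories_def)
    with step_mean_norm_sum_sq[OF centred unit memory, of l]
    show "(\<Sum>v\<in>unit_steps. step_prob p l v * ?G (v # l)) = (1 + 1 / real n) * ?G l + 1"
      by simp
  qed
  also have "\<dots> = (1 + 1 / real n) * (real n * harm n) + 1"
    using step by (simp only: path_mean_add path_mean_cmult path_mean_const)
  also have "\<dots> = real (Suc n) * harm (Suc n)"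
    using step(1) by (simp add: harm_Suc field_simps)
  finally show ?case .
qed

end

section \<open>One-step drift of the regularised logarithm\<close>

lemma ln_one_plus_lower_bound_3:
  assumes "\<bar>u\<bar> \<le> (1 / 2 :: real)"
  shows "u - u\<^sup>2 / 2 - \<bar>u\<bar> ^ 3 \<le> ln (1 + u)"
proof (cases "u \<ge> 0")
  case True
  have "ln (1 + 0) - 0 + 0\<^sup>2 / 2 \<le> ln (1 + u) - u + u\<^sup>2 / (2 :: real)"
  proof (rule DERIV_nonneg_imp_nondecreasing[OF True])
    fix x :: real assume "0 \<le> x" "x \<le> u"
    then show "\<exists>y. ((\<lambda>x. ln (1 + x) - x + x\<^sup>2 / 2) has_real_derivative y) (at x) \<and> 0 \<le> y"
      by (intro exI[of _ "x\<^sup>2 / (1 + x)"] conjI)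
        (auto intro!: derivative_eq_intros simp: field_simps power2_eq_square)
  qed
  then show ?thesis using True by simp (smt (verit) zero_le_power)
next
  case False
  define w where "w = - u"
  have w: "0 \<le> w" "w \<le> 1 / 2" using False assms by (auto simp: w_def)
  have "ln (1 - 0) + 0 + 0\<^sup>2 / 2 + 0 ^ 3 \<le> ln (1 - w) + w + w\<^sup>2 / 2 + w ^ 3"
  proof (rule DERIV_nonneg_imp_nondecreasing[OF w(1)])
    fix x :: real assume x: "0 \<le> x" "x \<le> w"
    have "((\<lambda>x. ln (1 - x) + x + x\<^sup>2 / 2 + x ^ 3) has_real_derivative (2 - 3 * x) * x\<^sup>2 / (1 - x)) (at x)"
      using x w by (auto intro!: derivative_eq_intros simp: field_simps power2_eq_square power3_eq_cube)
    moreover have "0 \<le> (2 - 3 * x) * x\<^sup>2 / (1 - x)" using x w by (intro divide_nonneg_nonneg mult_nonneg_nonneg) auto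
    ultimately show "\<exists>y. ((\<lambda>x. ln (1 - x) + x + x\<^sup>2 / 2 + x ^ 3) has_real_derivative y) (at x) \<and> 0 \<le> y"
      by blast
  qed
  then show ?thesis using False by (simp add: w_def)
qed

lemma powr_increment_bounds:
  assumes a: "0 < a" "a < 1" and n: "n \<ge> (1::real)"
  shows "a * n powr a / n - n powr a / n\<^sup>2 \<le> (n + 1) powr a - n powr a"
    and "0 \<le> (n + 1) powr a - n powr a" "(n + 1) powr a - n powr a \<le> 1"
    and "n powr a \<le> n"
proof -
  have eq: "(n + 1) powr a = n powr a * (1 + 1 / n) powr a"
  proof -
    have "n + 1 = n * (1 + 1 / n)" using n by (simp add: field_simps)
    then show ?thesis using n by (simp only: powr_mult)
  qed
  have "1 + a / n - 1 / n\<^sup>2 \<le> 1 + a * (1 / n - (1 / n)\<^sup>2)"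
    using a n by (simp add: field_simps)
  also have "\<dots> \<le> 1 + a * ln (1 + 1 / n)"
    using ln_one_plus_pos_lower_bound[of "1 / n"] a n by simp
  also have "\<dots> \<le> exp (a * ln (1 + 1 / n))" by (rule exp_ge_add_one_self)
  also have "\<dots> = (1 + 1 / n) powr a"
  proof -
    have "0 < 1 + 1 / n" using n by (intro add_pos_nonneg) auto
    then show ?thesis by (simp add: powr_def)
  qed
  finally have "1 + a / n - 1 / n\<^sup>2 \<le> (1 + 1 / n) powr a" .
  from mult_left_mono[OF this, of "n powr a"]
  show "a * n powr a / n - n powr a / n\<^sup>2 \<le> (n + 1) powr a - n powr a"
    unfolding eq by (simp add: algebra_simps)
  show "0 \<le> (n + 1) powr a - n powr a" using a n by (simp add: powr_mono2)
  show na: "n powr a \<le> n" using powr_mono[of a 1 n] a n by simp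
  have "(1 + 1 / n) powr a \<le> 1 + 1 / n" using powr_mono[of a 1 "1 + 1 / n"] a n by simp
  from mult_left_mono[OF this, of "n powr a"]
  have "(n + 1) powr a - n powr a \<le> n powr a / n" unfolding eq by (simp add: algebra_simps)
  also have "\<dots> \<le> 1" using na n by simp
  finally show "(n + 1) powr a - n powr a \<le> 1" .
qed

lemma unit_step_coordinates:
  assumes "v \<in> (unit_steps :: (real ^ 2) set)"
  shows "(v $ 1)\<^sup>2 + (v $ 2)\<^sup>2 = 1" "v $ 1 * v $ 2 = 0"
  using assms unfolding unit_steps_def by (auto simp: UNIV_2 axis_def)

text \<open>
  The number of horizontal minus the number of vertical steps. It measures how far the conditional
  covariance of the next step is from half the identity matrix.
\<close>

definition imbalance :: "(real ^ 2) list \<Rightarrow> real" where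
  "imbalance l = (\<Sum>u\<leftarrow>l. (u $ 1)\<^sup>2 - (u $ 2)\<^sup>2)"

lemma step_moments:
  fixes x :: "real ^ 2"
  assumes l: "set l \<subseteq> unit_steps" "l \<noteq> []" and S: "x = sum_list l"
  shows "(\<Sum>v\<in>unit_steps. step_prob (5 / 8) l v * (v \<bullet> x)) = (norm x)\<^sup>2 / (2 * real (length l))"
    and "(\<Sum>v\<in>unit_steps. step_prob (5 / 8) l v * (v \<bullet> x)\<^sup>2)
        \<le> (norm x)\<^sup>2 / 2 + \<bar>imbalance l\<bar> / (4 * real (length l)) * (norm x)\<^sup>2"
proof -
  have s: "(norm x)\<^sup>2 = (x $ 1)\<^sup>2 + (x $ 2)\<^sup>2"
    unfolding power2_norm_eq_inner by (simp add: inner_vec_def sum_2 power2_eq_square)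
  have "(\<Sum>u\<leftarrow>l. u \<bullet> y) = sum_list l \<bullet> y" for y by (induction l) (auto simp: inner_add_left)
  then have "(\<Sum>u\<leftarrow>l. u \<bullet> x) = (norm x)\<^sup>2" by (simp add: S power2_norm_eq_inner)
  then show "(\<Sum>v\<in>unit_steps. step_prob (5 / 8) l v * (v \<bullet> x)) = (norm x)\<^sup>2 / (2 * real (length l))"
    using sum_step_prob[OF l, of "5 / 8" "\<lambda>v. v \<bullet> x"]
    by (simp add: sum_unit_steps inner_axis UNIV_2)
  define A where "A = (norm x)\<^sup>2 / 2"
  define B where "B = ((x $ 1)\<^sup>2 - (x $ 2)\<^sup>2) / 2"
  \<comment> \<open>A horizontal step sees the first coordinate of \<open>x\<close> and a vertical one the second.\<close>
  have sq: "(u \<bullet> x)\<^sup>2 = A + ((u $ 1)\<^sup>2 - (u $ 2)\<^sup>2) * B"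
    if "u \<in> unit_steps" for u
  proof -
    note u = unit_step_coordinates[OF that]
    have "(u \<bullet> x)\<^sup>2 = (u $ 1)\<^sup>2 * (x $ 1)\<^sup>2 + (u $ 2)\<^sup>2 * (x $ 2)\<^sup>2"
    proof -
      have "(u \<bullet> x)\<^sup>2 = (u $ 1)\<^sup>2 * (x $ 1)\<^sup>2 + (u $ 2)\<^sup>2 * (x $ 2)\<^sup>2
          + 2 * (u $ 1 * u $ 2) * (x $ 1 * x $ 2)"
        by (simp add: inner_vec_def sum_2 power2_eq_square algebra_simps)
      then show ?thesis using u(2) by simp
    qed
    moreover have u2: "(u $ 2)\<^sup>2 = 1 - (u $ 1)\<^sup>2" using u(1) by linarith
    ultimately show ?thesis unfolding A_def B_def s u2 by (simp add: field_simps)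
  qed
  have "(\<Sum>u\<leftarrow>l. (u \<bullet> x)\<^sup>2)
      = real (length l) * A + imbalance l * B"
    using l(1) by (induction l) (auto simp: imbalance_def sq algebra_simps)
  moreover have "(\<Sum>v\<in>unit_steps. (v \<bullet> x)\<^sup>2) = 2 * (norm x)\<^sup>2"
    by (simp add: sum_unit_steps inner_axis' UNIV_2 s)
  ultimately have "(\<Sum>v\<in>unit_steps. step_prob (5 / 8) l v * (v \<bullet> x)\<^sup>2)
      = (norm x)\<^sup>2 / 2 + imbalance l * ((x $ 1)\<^sup>2 - (x $ 2)\<^sup>2) / (4 * real (length l))"
    using sum_step_prob[OF l, of "5 / 8" "\<lambda>v. (v \<bullet> x)\<^sup>2"] l(2)
    by (simp add: A_def B_def field_simps)
  also have "imbalance l * ((x $ 1)\<^sup>2 - (x $ 2)\<^sup>2) \<le> \<bar>imbalance l\<bar> * (norm x)\<^sup>2"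
  proof -
    have "\<bar>(x $ 1)\<^sup>2 - (x $ 2)\<^sup>2\<bar> \<le> (norm x)\<^sup>2" unfolding s by (simp add: abs_le_iff)
    then have "\<bar>imbalance l * ((x $ 1)\<^sup>2 - (x $ 2)\<^sup>2)\<bar> \<le> \<bar>imbalance l\<bar> * (norm x)\<^sup>2"
      unfolding abs_mult by (intro mult_left_mono) auto
    then show ?thesis by linarith
  qed
  finally show "(\<Sum>v\<in>unit_steps. step_prob (5 / 8) l v * (v \<bullet> x)\<^sup>2)
        \<le> (norm x)\<^sup>2 / 2 + \<bar>imbalance l\<bar> / (4 * real (length l)) * (norm x)\<^sup>2"
    by (simp add: divide_right_mono)
qed

text \<open>
  The balance of first- and second-order terms in the drift of \<open>ln x\<close>, where \<open>x = s + t + 36\<close>,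
  \<open>s\<close> is the squared norm of the walk, \<open>t = n powr a\<close> and \<open>\<rho>\<close> is the increment of \<open>t\<close>.
  In the plane the terms of order \<open>1 / x\<close> cancel, as the logarithm is harmonic there. What the
  regularisation leaves is a loss \<open>(1 - a) t / (n x)\<close>, because \<open>t\<close> grows more slowly than \<open>n\<close>, and a gain
  \<open>t / x\<^sup>2\<close>, because the regularised logarithm is strictly subharmonic. The gain outweighs the loss
  unless \<open>x\<close> is at least of order \<open>n\<close>, and then the loss is only of order \<open>t / n\<^sup>2\<close>.
\<close>

lemma log_drift_lower_bound:
  fixes s t x n D \<rho> a :: real
  assumes x: "x = s + t + 36" and s: "s \<ge> 0" and t: "t \<ge> 1" "t \<le> n" and n: "n \<ge> 1"
    and a: "0 < a" "a < 1" and D: "D \<ge> 0"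
    and \<rho>: "a * t / n - t / n\<^sup>2 \<le> \<rho>"
  shows "1 / n - (t / n\<^sup>2 + 39 / (n * t) + D / (2 * n * t) + 2 / t\<^sup>2)
    \<le> (s / n + 1 + \<rho>) / x - (s + D / (2 * n) * s + 2 * (s / n) + 2) / x\<^sup>2"
proof -
  have xt: "t \<le> x" "x > 0" "s \<le> x" using x s t by auto
  have inv: "1 / x \<le> 1 / t" using xt t by (simp add: field_simps)
  have e1: "1 / x = s / x\<^sup>2 + (t + 36) / x\<^sup>2"
  proof -
    have "s / x\<^sup>2 + (t + 36) / x\<^sup>2 = x / x\<^sup>2" by (simp add: x add_divide_distrib)
    then show ?thesis using xt by (simp add: power2_eq_square)
  qed
  have e2: "s / x\<^sup>2 \<le> 1 / x" using xt by (simp add: power2_eq_square field_simps)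
  have e3: "1 / x\<^sup>2 \<le> 1 / t\<^sup>2" using xt t by (intro divide_left_mono power_mono) auto
  have e4: "1 / n - (1 - a) * t / (n * x) - 37 / (n * x) \<le> (s / n + \<rho>) / x"
  proof -
    have "t / n\<^sup>2 \<le> 1 / n" using t n by (simp add: power2_eq_square field_simps)
    then have "(x - (1 - a) * t - 37) / n \<le> s / n + \<rho>"
      using \<rho> x by (simp add: diff_divide_distrib add_divide_distrib algebra_simps)
    then have "(x - (1 - a) * t - 37) / n / x \<le> (s / n + \<rho>) / x"
      using xt by (intro divide_right_mono) auto
    moreover have "(x - (1 - a) * t - 37) / n / x = 1 / n - (1 - a) * t / (n * x) - 37 / (n * x)"
      using xt n by (simp add: field_simps)
    ultimately show ?thesis by simp
  qed
  have e5: "- (t / n\<^sup>2) \<le> t / x\<^sup>2 - (1 - a) * t / (n * x)"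
  proof -
    have "(1 - a) * (t / (n * x)) \<le> 1 * (t / (n * x))"
      using a t n xt by (intro mult_right_mono) auto
    \<comment> \<open>Completing the square covers both regimes of \<open>x\<close> at once.\<close>
    moreover have "0 \<le> t * (1 / n - 1 / x)\<^sup>2 + t * (1 / (n * x))" using t n xt by simp
    then have "0 \<le> t / n\<^sup>2 + t / x\<^sup>2 - t / (n * x)"
      by (simp add: power2_diff algebra_simps power_divide)
    ultimately show ?thesis by simp
  qed
  have e6: "D / (2 * n) * s / x\<^sup>2 \<le> D / (2 * n * t)"
  proof -
    have "D / (2 * n) * (s / x\<^sup>2) \<le> D / (2 * n) * (1 / t)"
      using e2 inv D n by (intro mult_left_mono) auto
    then show ?thesis by simp
  qed
  have e7: "2 * (s / n) / x\<^sup>2 + 37 / (n * x) \<le> 39 / (n * t)"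
  proof -
    have "2 * (s / n) / x\<^sup>2 + 37 / (n * x) = (2 / n) * (s / x\<^sup>2) + (37 / n) * (1 / x)" by simp
    also have "\<dots> \<le> (2 / n) * (1 / t) + (37 / n) * (1 / t)"
      using e2 inv n by (intro add_mono mult_left_mono) auto
    also have "\<dots> = 39 / (n * t)" by (simp add: add_divide_distrib[symmetric])
    finally show ?thesis .
  qed
  have e8: "2 / x\<^sup>2 \<le> 2 / t\<^sup>2" using e3 by simp
  have "0 \<le> 36 / x\<^sup>2" by simp
  have "(s / n + 1 + \<rho>) / x = (s / n + \<rho>) / x + 1 / x" by (simp add: add_divide_distrib)
  moreover have "(s + D / (2 * n) * s + 2 * (s / n) + 2) / x\<^sup>2
      = s / x\<^sup>2 + D / (2 * n) * s / x\<^sup>2 + 2 * (s / n) / x\<^sup>2 + 2 / x\<^sup>2"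
    by (simp add: add_divide_distrib)
  moreover have "(t + 36) / x\<^sup>2 = t / x\<^sup>2 + 36 / x\<^sup>2" by (simp add: add_divide_distrib)
  ultimately show ?thesis using e1 e4 e5 e6 e7 e8 \<open>0 \<le> 36 / x\<^sup>2\<close> by linarith
qed

text \<open>
  The constant 36 makes one step change the argument of the logarithm by a factor between
  \<open>1 / 2\<close> and \<open>3 / 2\<close> even when the walk is near the origin, so Taylor's expansion applies at all times.
\<close>

definition log_potential :: "real \<Rightarrow> (real ^ 2) list \<Rightarrow> real" where
  "log_potential a l =
     ln (real (length l)) - ln ((norm (sum_list l))\<^sup>2 + real (length l) powr a + 36)"

text \<open>
  The errors in the drift come, in order, from the slow growth of the regularisation, from
  lower-order products with a factor \<open>1 / n\<close>, from the imbalance of the covariance, from the square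
  of the bounded part of the increment, and from the third-order Taylor remainder.
\<close>

definition drift_error :: "real \<Rightarrow> (real ^ 2) list \<Rightarrow> real" where
  "drift_error a l = (let n = real (length l) in
     n powr (a - 2) + 39 * n powr (- 1 - a) + ((imbalance l)\<^sup>2 / n + 1) * n powr (- 1 / 2 - a)
     + 2 * n powr (- 2 * a) + 27 * n powr (- 3 / 2 * a))"

lemma drift_error_nonneg: "0 \<le> drift_error a l"
  unfolding drift_error_def Let_def by (intro add_nonneg_nonneg mult_nonneg_nonneg) auto

text \<open>
  Expand \<open>ln (x * (1 + u v))\<close> to second order, where \<open>u v\<close> is the relative change of
  \<open>x = |S n|\<^sup>2 + n powr a + 36\<close> caused by the step \<open>v\<close>. By Cauchy-Schwarz \<open>u v\<close> is at most
  \<open>3 / sqrt x\<close>, so the cubic remainder is at most \<open>27 / (x * sqrt x)\<close>.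
\<close>

lemma log_potential_drift:
  assumes a: "0 < a" "a < 1" and l: "l \<noteq> []" "set l \<subseteq> unit_steps"
  shows "(\<Sum>v\<in>unit_steps. step_prob (5 / 8) l v * log_potential a (v # l))
       \<le> log_potential a l + drift_error a l"
proof -
  define n where "n = real (length l)"
  define z where "z = sum_list l"
  define s where "s = (norm z)\<^sup>2"
  define t where "t = n powr a"
  define \<rho> where "\<rho> = (n + 1) powr a - n powr a"
  define x where "x = s + t + 36"
  define u where "u = (\<lambda>v. (2 * (v \<bullet> z) + 1 + \<rho>) / x)"
  define D where "D = \<bar>imbalance l\<bar>"
  define R where "R = 27 / (x * sqrt x)"
  let ?q = "step_prob (5 / 8) l"
  have n: "n \<ge> 1" using l(1) by (simp add: n_def Suc_leI)
  have t: "t \<ge> 1" "t \<le> n" using n a powr_increment_bounds(4)[OF a n] by (auto simp: t_def ge_one_powr_ge_zero)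
  have s: "s \<ge> 0" by (simp add: s_def)
  have \<rho>: "0 \<le> \<rho>" "\<rho> \<le> 1" "a * t / n - t / n\<^sup>2 \<le> \<rho>"
    using powr_increment_bounds[OF a n] by (auto simp: \<rho>_def t_def)
  have x: "x > 0" "x \<ge> t" "x \<ge> 36" using s t by (auto simp: x_def)
  have rx: "6 \<le> sqrt x" using real_sqrt_le_mono[OF x(3)] real_sqrt_abs[of 6] by simp
  have q: "0 \<le> ?q v" for v by (rule step_prob_nonneg) auto
  have q1: "(\<Sum>v\<in>unit_steps. ?q v) = 1" by (rule sum_step_prob_eq_1[OF l(2,1)])
  have W: "log_potential a (v # l) \<le> ln (n + 1) - ln x - u v + (u v)\<^sup>2 / 2 + R"
    if v: "v \<in> unit_steps" for v
  proof -
    have nv: "norm v = 1" using norm_unit_step[OF v] .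
    have "\<bar>v \<bullet> z\<bar> \<le> sqrt s"
      using Cauchy_Schwarz_ineq2[of v z] nv by (simp add: s_def)
    also have "\<dots> \<le> sqrt x" using x t s by (simp add: x_def)
    finally have "\<bar>2 * (v \<bullet> z) + 1 + \<rho>\<bar> \<le> 3 * sqrt x" using \<rho> rx by linarith
    then have "\<bar>u v\<bar> \<le> 3 * sqrt x / x"
      unfolding u_def abs_divide using x by (simp add: divide_right_mono)
    also have "\<dots> = 3 / sqrt x" using x(1) by (simp add: field_simps)
    finally have ub: "\<bar>u v\<bar> \<le> 3 / sqrt x" .
    also have "\<dots> \<le> 3 / 6" using rx x(1) by (intro divide_left_mono) auto
    finally have uh: "\<bar>u v\<bar> \<le> 1 / 2" by simp
    have "\<bar>u v\<bar> ^ 3 \<le> (3 / sqrt x) ^ 3" using ub by (intro power_mono) auto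
    also have "\<dots> = R" using x(1) by (simp add: R_def power_divide power3_eq_cube)
    finally have "u v - (u v)\<^sup>2 / 2 - R \<le> ln (1 + u v)"
      using ln_one_plus_lower_bound_3[OF uh] by linarith
    moreover have "ln (x * (1 + u v)) = ln x + ln (1 + u v)"
      using x(1) uh by (intro ln_mult_pos) (auto simp: abs_le_iff)
    moreover have "x * (1 + u v) = (norm (v + z))\<^sup>2 + (n + 1) powr a + 36"
    proof -
      have "v \<bullet> v = 1" using nv by (simp add: dot_square_norm)
      then have "(norm (v + z))\<^sup>2 = s + 2 * (v \<bullet> z) + 1"
        by (simp add: s_def power2_norm_eq_inner inner_add_left inner_add_right inner_commute)
      moreover have "x * (1 + u v) = x + (2 * (v \<bullet> z) + 1 + \<rho>)"
      proof -
        have "x * (1 + y / x) = x + y" for y using x(1) by (simp add: field_simps)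
        then show ?thesis unfolding u_def .
      qed
      ultimately show ?thesis by (simp add: x_def \<rho>_def t_def)
    qed
    ultimately show ?thesis by (simp add: log_potential_def n_def z_def add.commute)
  qed
  have m1: "(\<Sum>v\<in>unit_steps. ?q v * u v) = (s / n + 1 + \<rho>) / x"
  proof -
    have "(\<Sum>v\<in>unit_steps. ?q v * u v)
        = (\<Sum>v\<in>unit_steps. (?q v * (v \<bullet> z)) * (2 / x) + ?q v * ((1 + \<rho>) / x))"
      by (intro sum.cong refl) (simp add: u_def add_divide_distrib algebra_simps)
    also have "\<dots> = (\<Sum>v\<in>unit_steps. ?q v * (v \<bullet> z)) * (2 / x) + (1 + \<rho>) / x"
      by (simp only: sum.distrib sum_distrib_right[symmetric] q1 mult_1_left)
    also have "(\<Sum>v\<in>unit_steps. ?q v * (v \<bullet> z)) = s / (2 * n)"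
      using step_moments(1)[OF l(2,1) z_def] by (simp add: s_def n_def)
    finally show ?thesis by (simp add: add_divide_distrib)
  qed
  have m2: "(\<Sum>v\<in>unit_steps. ?q v * (u v)\<^sup>2) / 2 \<le> (s + D / (2 * n) * s + 2 * (s / n) + 2) / x\<^sup>2"
  proof -
    have "(\<Sum>v\<in>unit_steps. ?q v * (u v)\<^sup>2)
        = (\<Sum>v\<in>unit_steps. (?q v * (v \<bullet> z)\<^sup>2) * (4 / x\<^sup>2)
            + (?q v * (v \<bullet> z)) * (4 * (1 + \<rho>) / x\<^sup>2) + ?q v * ((1 + \<rho>)\<^sup>2 / x\<^sup>2))"
    proof (intro sum.cong refl)
      fix v
      have "(2 * (v \<bullet> z) + 1 + \<rho>)\<^sup>2 = 4 * (v \<bullet> z)\<^sup>2 + 4 * (1 + \<rho>) * (v \<bullet> z) + (1 + \<rho>)\<^sup>2"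
        by (simp add: power2_eq_square algebra_simps)
      then have "(u v)\<^sup>2 = (4 * (v \<bullet> z)\<^sup>2 + 4 * (1 + \<rho>) * (v \<bullet> z) + (1 + \<rho>)\<^sup>2) / x\<^sup>2"
        by (simp only: u_def power_divide)
      then show "?q v * (u v)\<^sup>2 = (?q v * (v \<bullet> z)\<^sup>2) * (4 / x\<^sup>2)
            + (?q v * (v \<bullet> z)) * (4 * (1 + \<rho>) / x\<^sup>2) + ?q v * ((1 + \<rho>)\<^sup>2 / x\<^sup>2)"
        by (simp only: divide_inverse) (simp only: algebra_simps)
    qed
    also have "\<dots> = (\<Sum>v\<in>unit_steps. ?q v * (v \<bullet> z)\<^sup>2) * (4 / x\<^sup>2)
        + (\<Sum>v\<in>unit_steps. ?q v * (v \<bullet> z)) * (4 * (1 + \<rho>) / x\<^sup>2) + (1 + \<rho>)\<^sup>2 / x\<^sup>2"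
      by (simp only: sum.distrib sum_distrib_right[symmetric] q1 mult_1_left)
    also have "(\<Sum>v\<in>unit_steps. ?q v * (v \<bullet> z)) = s / (2 * n)"
      using step_moments(1)[OF l(2,1) z_def] by (simp add: s_def n_def)
    also have "(\<Sum>v\<in>unit_steps. ?q v * (v \<bullet> z)\<^sup>2) * (4 / x\<^sup>2)
        \<le> (s / 2 + D / (4 * n) * s) * (4 / x\<^sup>2)"
      using step_moments(2)[OF l(2,1) z_def] by (intro mult_right_mono) (auto simp: s_def n_def D_def)
    also have "s / (2 * n) * (4 * (1 + \<rho>) / x\<^sup>2) \<le> s / (2 * n) * (8 / x\<^sup>2)"
      using \<rho> s n by (intro mult_left_mono divide_right_mono) auto
    also have "(1 + \<rho>)\<^sup>2 / x\<^sup>2 \<le> 2\<^sup>2 / x\<^sup>2"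
      using \<rho> by (intro divide_right_mono power_mono) auto
    finally have "(\<Sum>v\<in>unit_steps. ?q v * (u v)\<^sup>2)
      \<le> (s / 2 + D / (4 * n) * s) * (4 / x\<^sup>2) + s / (2 * n) * (8 / x\<^sup>2) + 2\<^sup>2 / x\<^sup>2" by simp
    also have "\<dots> = 2 * ((s + D / (2 * n) * s + 2 * (s / n) + 2) / x\<^sup>2)"
      by (simp add: add_divide_distrib algebra_simps)
    finally show ?thesis by linarith
  qed
  have ln_n: "ln (n + 1) \<le> ln n + 1 / n"
  proof -
    have "0 < 1 + 1 / n" using n by (intro add_pos_nonneg) auto
    then have "ln (n * (1 + 1 / n)) = ln n + ln (1 + 1 / n)" using n by (intro ln_mult_pos) auto
    moreover have "n * (1 + 1 / n) = n + 1" using n by (simp add: field_simps)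
    ultimately have "ln (n + 1) = ln n + ln (1 + 1 / n)" by simp
    then show ?thesis using ln_add_one_self_le_self[of "1 / n"] n by simp
  qed
  have R: "R \<le> 27 * n powr (- 3 / 2 * a)"
  proof -
    have "t * sqrt t \<le> x * sqrt x" using x t by (intro mult_mono) auto
    then have "R \<le> 27 / (t * sqrt t)" using t x unfolding R_def by (intro divide_left_mono) auto
    also have "t * sqrt t = n powr (a + a / 2)"
      unfolding powr_add using n by (simp add: t_def powr_half_sqrt[symmetric] powr_powr)
    also have "27 / n powr (a + a / 2) = 27 * n powr (- (a + a / 2))"
      unfolding powr_minus_divide by simp
    also have "- (a + a / 2) = - 3 / 2 * a" by simp
    finally show ?thesis .
  qed
  \<comment> \<open>Only the square of the imbalance has an explicit mean, so pass to it by AM-GM.\<close>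
  have "D / (2 * n * t) \<le> ((imbalance l)\<^sup>2 / n + 1) * n powr (- 1 / 2 - a)"
  proof -
    have "2 * D * sqrt n \<le> D\<^sup>2 + n"
      using zero_le_power2[of "D - sqrt n"] n by (simp add: power2_diff)
    moreover have "0 \<le> D * sqrt n" using n by (simp add: D_def)
    ultimately have "D * sqrt n / (2 * n) \<le> (D\<^sup>2 + n) / n"
      using n by (simp add: field_simps)
    then have "D * sqrt n / (2 * n) * (1 / (sqrt n * t)) \<le> (D\<^sup>2 + n) / n * (1 / (sqrt n * t))"
      using n t by (intro mult_right_mono) auto
    moreover have "1 / (sqrt n * t) = n powr (- 1 / 2 - a)"
    proof -
      have "n powr (- 1 / 2 - a) = n powr (- (1 / 2 + a))" by simp
      also have "\<dots> = 1 / (n powr (1 / 2) * n powr a)" unfolding powr_minus_divide powr_add ..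
      finally show ?thesis using n by (simp add: t_def powr_half_sqrt)
    qed
    moreover have "D * sqrt n / (2 * n) * (1 / (sqrt n * t)) = D / (2 * n * t)"
      using n by simp
    moreover have "(D\<^sup>2 + n) / n = (imbalance l)\<^sup>2 / n + 1"
      using n by (simp add: D_def add_divide_distrib)
    ultimately show ?thesis by simp
  qed
  moreover have "t / n\<^sup>2 = n powr (a - 2)"
    using n by (simp add: t_def powr_diff powr_numeral)
  moreover have "39 / (n * t) = 39 * n powr (- 1 - a)"
  proof -
    have "n powr (- 1 - a) = 1 / (n * t)"
    proof -
      have "n powr (- 1 - a) = n powr (- (1 + a))" by simp
      also have "\<dots> = 1 / (n powr 1 * n powr a)" unfolding powr_minus_divide powr_add ..
      finally show ?thesis using n by (simp add: t_def)
    qed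
    then show ?thesis by simp
  qed
  moreover have "2 / t\<^sup>2 = 2 * n powr (- 2 * a)"
  proof -
    have "n powr (- 2 * a) = 1 / t\<^sup>2"
    proof -
      have "n powr (- 2 * a) = n powr (- (a + a))" by simp
      also have "\<dots> = 1 / (n powr a * n powr a)" unfolding powr_minus_divide powr_add ..
      finally show ?thesis by (simp add: t_def power2_eq_square)
    qed
    then show ?thesis by simp
  qed
  moreover have "0 \<le> D" by (simp add: D_def)
  moreover note log_drift_lower_bound[OF x_def s t n a \<open>0 \<le> D\<close> \<rho>(3)] R
  ultimately have err: "1 / n + (\<Sum>v\<in>unit_steps. ?q v * (u v)\<^sup>2) / 2 + R
      \<le> (s / n + 1 + \<rho>) / x + drift_error a l"
    using m2 unfolding drift_error_def Let_def n_def[symmetric] by linarith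
  have "(\<Sum>v\<in>unit_steps. ?q v * log_potential a (v # l))
      \<le> (\<Sum>v\<in>unit_steps. ?q v * (ln (n + 1) - ln x + R) - ?q v * u v + ?q v * (u v)\<^sup>2 / 2)"
  proof (rule sum_mono)
    fix v assume "v \<in> (unit_steps :: (real ^ 2) set)"
    from mult_left_mono[OF W[OF this] q[of v]]
    show "?q v * log_potential a (v # l)
        \<le> ?q v * (ln (n + 1) - ln x + R) - ?q v * u v + ?q v * (u v)\<^sup>2 / 2"
      by (simp add: algebra_simps)
  qed
  also have "\<dots> = ln (n + 1) - ln x + R - (s / n + 1 + \<rho>) / x
      + (\<Sum>v\<in>unit_steps. ?q v * (u v)\<^sup>2) / 2"
    by (simp add: sum.distrib sum_subtractf sum_distrib_right[symmetric] q1 m1 sum_divide_distrib[symmetric])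
  also have "\<dots> \<le> ln n - ln x + drift_error a l" using err ln_n by linarith
  also have "\<dots> = log_potential a l + drift_error a l"
    by (simp add: log_potential_def n_def x_def s_def t_def z_def)
  finally show ?thesis .
qed

section \<open>Doubly exponential stages\<close>

text \<open>
  Doubly exponential stages are the right grid for levels proportional to \<open>ln n\<close>: within a stage
  \<open>ln n\<close> varies by a factor of 2 only, while \<open>ln (ln n) / ln n\<close> is summable over the stages.
\<close>

lemma eventually_stage:
  assumes "eventually (\<lambda>j. \<forall>k\<in>{1..2 ^ 2 ^ Suc j}. P j k) sequentially"
  shows "eventually (\<lambda>n::nat. \<exists>j. 2 ^ 2 ^ j \<le> n \<and> P j n) sequentially"
proof -
  obtain J where J: "\<And>j k. J \<le> j \<Longrightarrow> k \<in> {1..2 ^ 2 ^ Suc j} \<Longrightarrow> P j k"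
    using assms unfolding eventually_sequentially by blast
  have "\<exists>j. 2 ^ 2 ^ j \<le> n \<and> P j n" if n: "2 ^ 2 ^ J \<le> n" for n :: nat
  proof -
    define k where "k = (LEAST k. n < 2 ^ 2 ^ k)"
    have "n < 2 ^ 2 ^ n"
      using less_exp[of n] less_exp[of "2 ^ n"] by (rule less_trans)
    then have k: "n < 2 ^ 2 ^ k" unfolding k_def by (rule LeastI)
    have "J < k"
    proof (rule ccontr)
      assume "\<not> J < k"
      then have "(2::nat) ^ 2 ^ k \<le> 2 ^ 2 ^ J" by (intro power_increasing) auto
      with k n show False by simp
    qed
    then obtain j where j: "k = Suc j" "J \<le> j" by (cases k) auto
    have "\<not> n < 2 ^ 2 ^ j" using j(1) not_less_Least[of j "\<lambda>k. n < 2 ^ 2 ^ k"] k_def by simp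
    then have "2 ^ 2 ^ j \<le> n" by simp
    moreover have "0 < n" using n by (rule less_le_trans[rotated]) simp
    ultimately show ?thesis using J[OF j(2), of n] k j(1) by (intro exI[of _ j]) simp
  qed
  then show ?thesis by (rule eventually_sequentiallyI)
qed

lemma harm_le_ln:
  assumes "n \<ge> 1"
  shows "(harm n :: real) \<le> 1 + ln (real n)"
proof (cases n)
  case (Suc m)
  have "harm (Suc m) - ln (real (Suc m)) \<le> harm (Suc 0) - ln (real (Suc 0))"
    using decseqD[OF decseq_harm_diff_ln, of 0 m] by simp
  then show ?thesis using Suc by (simp add: harm_expand)
qed (use assms in simp)

lemma harm_stage: "(harm (2 ^ 2 ^ Suc j) :: real) \<le> 1 + 2 * 2 ^ j"
proof -
  have "harm (2 ^ 2 ^ Suc j) \<le> 1 + ln (2 ^ 2 ^ Suc j :: real)"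
    using harm_le_ln[of "2 ^ 2 ^ Suc j"] by simp
  also have "ln (2 ^ 2 ^ Suc j :: real) = 2 ^ Suc j * ln 2" by (simp add: ln_realpow)
  also have "\<dots> \<le> 2 ^ Suc j * 1" using ln_le_minus_one[of 2] by (intro mult_left_mono) auto
  finally show ?thesis by simp
qed

lemma stage_ln:
  assumes "2 ^ 2 ^ j \<le> n"
  shows "2 ^ j * ln 2 \<le> ln (real n)"
proof -
  have "(2 :: real) ^ 2 ^ j \<le> real n" using assms by (metis of_nat_le_iff of_nat_numeral of_nat_power)
  then have "ln ((2 :: real) ^ 2 ^ j) \<le> ln (real n)"
    by (subst ln_le_cancel_iff) (auto intro: less_le_trans[of 0 "2 ^ 2 ^ j"])
  then show ?thesis by (simp add: ln_realpow)
qed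

section \<open>Upper bound\<close>

context merw
begin

lemma walk_eq_sum_history: "\<omega> \<in> space M \<Longrightarrow> S n \<omega> = sum_list (history \<sigma> n \<omega>)"
  by (induction n) (auto simp: walk_0 walk_Suc add.commute)

text \<open>
  The level \<open>4 ^ j = (2 ^ j)\<^sup>2\<close> is of order \<open>(ln n)\<^sup>2\<close> in stage \<open>j\<close>, large enough for the bounds
  \<open>harm N / 4 ^ j\<close>, of order \<open>2 ^ j / 4 ^ j\<close>, to be summable.
\<close>

lemma AE_norm_walk_sq_upper:
  assumes memory: "p - (1 - p) / (2 * real CARD('d) - 1) = 1 / 2"
  shows "AE \<omega> in M. eventually (\<lambda>n. (norm (S n \<omega>))\<^sup>2
      \<le> real n * (1 + ln (real n) + 4 * (ln (real n))\<^sup>2)) sequentially"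
proof -
  define U :: "(real, 'd) vec list \<Rightarrow> real"
    where "U = (\<lambda>l. (norm (\<Sum>u\<leftarrow>l. u))\<^sup>2 / real (length l) - harm (length l))"
  have "AE \<omega> in M. eventually (\<lambda>j. \<forall>k\<in>{1..2 ^ 2 ^ Suc j}. U (history \<sigma> k \<omega>) < 4 ^ j) sequentially"
  proof (rule eventually_below_level[where g = "\<lambda>_. 0" and b = "\<lambda>j. 1 + 2 * 2 ^ j"])
    fix l :: "(real, 'd) vec list" assume l: "l \<noteq> []" "set l \<subseteq> unit_steps"
    define n where "n = real (length l)"
    have n: "n > 0" using l by (simp add: n_def)
    have "(\<Sum>v\<in>unit_steps. step_prob p l v * U (v # l))
        = (\<Sum>v\<in>unit_steps. (step_prob p l v * (norm (\<Sum>u\<leftarrow>v # l. u))\<^sup>2) * (1 / (n + 1))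
            - step_prob p l v * harm (Suc (length l)))"
      by (intro sum.cong refl) (simp add: U_def n_def algebra_simps)
    also have "\<dots> = (\<Sum>v\<in>unit_steps. step_prob p l v * (norm (\<Sum>u\<leftarrow>v # l. u))\<^sup>2) * (1 / (n + 1))
        - harm (Suc (length l))"
      by (simp only: sum_subtractf sum_distrib_right[symmetric] sum_step_prob_eq_1[OF l(2,1)] mult_1_left)
    also have "(\<Sum>v\<in>unit_steps. step_prob p l v * (norm (\<Sum>u\<leftarrow>v # l. u))\<^sup>2)
        = (1 + 1 / n) * (norm (\<Sum>u\<leftarrow>l. u))\<^sup>2 + 1"
      unfolding n_def
      by (rule step_mean_norm_sum_sq[OF _ _ memory l(2,1)]) (simp_all add: sum_unit_steps_eq_0 norm_unit_step)
    also have "((1 + 1 / n) * (norm (\<Sum>u\<leftarrow>l. u))\<^sup>2 + 1) * (1 / (n + 1)) - harm (Suc (length l)) = U l"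
    proof -
      have "((1 + 1 / n) * y + 1) * (1 / (n + 1)) = y / n + 1 / (n + 1)" for y
      proof -
        have "(1 + 1 / n) * (1 / (n + 1)) = ((n + 1) / n) * (1 / (n + 1))"
          using n by (simp only: add_divide_distrib divide_self)
        also have "\<dots> = 1 / n" using n by simp
        finally have c: "(1 + 1 / n) * (1 / (n + 1)) = 1 / n" .
        have "((1 + 1 / n) * y + 1) * (1 / (n + 1)) = ((1 + 1 / n) * (1 / (n + 1))) * y + 1 / (n + 1)"
          by (simp only: distrib_right mult_1_left) (simp only: mult_ac)
        then show ?thesis unfolding c by simp
      qed
      then show ?thesis by (simp add: U_def harm_Suc n_def inverse_eq_divide add.commute)
    qed
    finally show "(\<Sum>v\<in>unit_steps. step_prob p l v * U (v # l)) \<le> U l + 0" by simp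
  next
    fix j
    let ?N = "2 ^ 2 ^ Suc j :: nat"
    have "path_mean ?N (\<lambda>l. max 0 (- U l)) \<le> path_mean ?N (\<lambda>_. harm ?N)"
    proof (rule path_mean_mono)
      fix l :: "(real, 'd) vec list" assume "l \<in> histories ?N"
      then have "length l = ?N" by (simp add: histories_def)
      then show "max 0 (- U l) \<le> harm ?N" unfolding U_def by (simp add: harm_nonneg)
    qed
    also have "\<dots> = harm ?N" by (rule path_mean_const) simp
    finally have "path_mean ?N (\<lambda>l. max 0 (- U l)) \<le> 1 + 2 * 2 ^ j" using harm_stage[of j] by simp
    moreover have "(\<Sum>k=1..<?N. path_mean k (\<lambda>_. 0)) = 0"
      by (intro sum.neutral ballI path_mean_const) auto
    ultimately show "U [axis 1 1] + (\<Sum>k=1..<?N. path_mean k (\<lambda>_. 0))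
        + path_mean ?N (\<lambda>l. max 0 (- U l)) \<le> 1 + 2 * 2 ^ j"
      by (simp add: U_def harm_expand)
  next
    have "summable (\<lambda>j. (1 / 4 :: real) ^ j + 2 * (1 / 2) ^ j)"
      by (intro summable_add summable_mult summable_geometric) auto
    moreover have "(1 / 4) ^ j + 2 * (1 / 2) ^ j = (1 + 2 * 2 ^ j) / (4 :: real) ^ j" for j
    proof -
      have "(1 / 2 :: real) ^ j = 2 ^ j / 4 ^ j" by (simp add: power_divide[symmetric])
      then show ?thesis by (simp add: power_one_over add_divide_distrib)
    qed
    ultimately show "summable (\<lambda>j. (1 + 2 * 2 ^ j) / (4 :: real) ^ j)" by simp
  qed auto
  then show ?thesis
    using AE_space
  proof eventually_elim
    case (elim \<omega>)
    show ?case
      using eventually_stage[OF elim(1)] eventually_ge_at_top[of 1]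
    proof eventually_elim
      case (elim n)
      then obtain j where j: "2 ^ 2 ^ j \<le> n" "U (history \<sigma> n \<omega>) < 4 ^ j" by blast
      have "(1 / 2 :: real) \<le> ln 2" using ln2_ge_two_thirds by simp
      then have "2 ^ j * (1 / 2) \<le> 2 ^ j * ln (2 :: real)" by (intro mult_left_mono) auto
      then have "2 ^ j \<le> 2 * ln (real n)" using stage_ln[OF j(1)] by linarith
      then have "(2 ^ j)\<^sup>2 \<le> (2 * ln (real n))\<^sup>2" by (intro power_mono) auto
      moreover have "(2 ^ j)\<^sup>2 = (4 :: real) ^ j" by (simp add: power_mult[symmetric] mult.commute[of j]) (simp add: power_mult)
      ultimately have "U (history \<sigma> n \<omega>) \<le> 4 * (ln (real n))\<^sup>2"
        using j(2) by (simp add: power_mult_distrib)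
      then have "(norm (S n \<omega>))\<^sup>2 / real n \<le> 1 + ln (real n) + 4 * (ln (real n))\<^sup>2"
        using harm_le_ln[OF elim(2)] walk_eq_sum_history[OF \<open>\<omega> \<in> space M\<close>, of n] by (simp add: U_def)
      then show ?case using elim(2) by (simp add: divide_le_eq mult.commute)
    qed
  qed
qed

end

section \<open>Lower bound\<close>

definition mean_drift_error :: "real \<Rightarrow> nat \<Rightarrow> real" where
  "mean_drift_error a k = (let n = real k in
     n powr (a - 2) + 39 * n powr (- 1 - a) + (harm k + 1) * n powr (- 1 / 2 - a)
     + 2 * n powr (- 2 * a) + 27 * n powr (- 3 / 2 * a))"

lemma mean_drift_error_nonneg: "0 \<le> mean_drift_error a k"
  unfolding mean_drift_error_def Let_def
  by (intro add_nonneg_nonneg mult_nonneg_nonneg harm_nonneg) auto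

lemma summable_mean_drift_error:
  assumes a: "3 / 4 \<le> a" "a < 1"
  shows "summable (mean_drift_error a)"
proof -
  have pow: "summable (\<lambda>k. c * real k powr s)" if "s < - 1" for c s
    using that summable_real_powr_iff[of s] by (intro summable_mult) simp
  show ?thesis
  proof (rule summable_comparison_test')
    show "summable (\<lambda>k. real k powr (a - 2) + 39 * real k powr (- 1 - a) + 10 * real k powr (- 3 / 8 - a)
        + 2 * real k powr (- 2 * a) + 27 * real k powr (- 3 / 2 * a))"
      using a pow[of "a - 2" 1] pow[of "- 1 - a" 39] pow[of "- 3 / 8 - a" 10] pow[of "- 2 * a" 2]
        pow[of "- 3 / 2 * a" 27]
      by (intro summable_add) simp_all
    fix k :: nat assume k: "1 \<le> k"
    have one: "1 \<le> real k powr (1 / 8)" using k by (simp add: ge_one_powr_ge_zero)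
    \<comment> \<open>The exponent \<open>1 / 8\<close> absorbs the logarithm and still leaves \<open>- 3 / 8 - a < - 1\<close>.\<close>
    have "harm k + 1 \<le> 2 + ln (real k)" using harm_le_ln[OF k] by simp
    also have "\<dots> \<le> 2 * real k powr (1 / 8) + 8 * real k powr (1 / 8)"
      using one ln_powr_bound[of "real k" "1 / 8"] k by (intro add_mono) auto
    finally have "harm k + 1 \<le> 10 * real k powr (1 / 8)" by simp
    then have "(harm k + 1) * real k powr (- 1 / 2 - a)
        \<le> 10 * real k powr (1 / 8) * real k powr (- 1 / 2 - a)"
      by (rule mult_right_mono) simp
    also have "\<dots> = 10 * real k powr (- 3 / 8 - a)" by (simp add: powr_add[symmetric])
    finally show "norm (mean_drift_error a k) \<le> real k powr (a - 2) + 39 * real k powr (- 1 - a)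
        + 10 * real k powr (- 3 / 8 - a) + 2 * real k powr (- 2 * a) + 27 * real k powr (- 3 / 2 * a)"
      using mean_drift_error_nonneg[of a k] by (simp add: mean_drift_error_def Let_def)
  qed
qed

lemma path_mean_drift_error:
  fixes S :: "nat \<Rightarrow> 'a \<Rightarrow> real ^ 2"
  assumes "merw M (5 / 8) \<sigma> K S" and n: "n \<ge> 1"
  shows "merw.path_mean M \<sigma> n (drift_error a) = mean_drift_error a n"
proof -
  interpret merw M "5 / 8" \<sigma> K S by fact
  let ?c = "real n powr (- 1 / 2 - a)"
  define r where "r = real n powr (a - 2) + 39 * real n powr (- 1 - a) + ?c
     + 2 * real n powr (- 2 * a) + 27 * real n powr (- 3 / 2 * a)"
  have "path_mean n (drift_error a) = path_mean n (\<lambda>l. ?c / n * (imbalance l)\<^sup>2 + r)"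
    by (rule path_mean_cong) (simp add: histories_def drift_error_def r_def Let_def algebra_simps)
  also have "\<dots> = ?c / n * path_mean n (\<lambda>l. (imbalance l)\<^sup>2) + r"
    using n by (simp only: path_mean_add path_mean_cmult path_mean_const)
  also have "path_mean n (\<lambda>l. (imbalance l)\<^sup>2) = real n * harm n"
  proof -
    have "\<bar>(v $ 1)\<^sup>2 - (v $ 2)\<^sup>2\<bar> = 1" if "v \<in> unit_steps" for v :: "real ^ 2"
      using that unfolding unit_steps_def by (auto simp: UNIV_2 axis_def)
    then show ?thesis
      using path_mean_norm_sum_sq[of "\<lambda>u. (u $ 1)\<^sup>2 - (u $ 2)\<^sup>2" n] n
      by (simp add: imbalance_def sum_unit_steps UNIV_2 axis_def)
  qed
  also have "?c / n * (real n * harm n) + r = mean_drift_error a n"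
    using n by (simp add: mean_drift_error_def r_def Let_def algebra_simps)
  finally show ?thesis .
qed

text \<open>
  Jensen's inequality for the logarithm, in the form of the tangent bound
  \<open>ln z \<le> ln A + z / A - 1\<close> at \<open>A = harm n + 37\<close>, which bounds the mean of
  \<open>(|S n|\<^sup>2 + n powr a + 36) / n\<close>.
\<close>

lemma path_mean_neg_log_potential:
  fixes S :: "nat \<Rightarrow> 'a \<Rightarrow> real ^ 2"
  assumes "merw M (5 / 8) \<sigma> K S" and n: "n \<ge> 1" and a: "0 < a" "a < 1"
  shows "merw.path_mean M \<sigma> n (\<lambda>l. max 0 (- log_potential a l)) \<le> ln (harm n + 37) + 1"
proof -
  interpret merw M "5 / 8" \<sigma> K S by fact
  define A where "A = (harm n + 37 :: real)"
  have A: "A \<ge> 1" using harm_nonneg[of n] unfolding A_def by (smt (verit))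
  have "path_mean n (\<lambda>l. max 0 (- log_potential a l))
      \<le> path_mean n (\<lambda>l. 1 / (real n * A) * (norm (\<Sum>u\<leftarrow>l. u))\<^sup>2 + (ln A + 37 / A))"
  proof (rule path_mean_mono)
    fix l :: "(real ^ 2) list" assume "l \<in> histories n"
    then have len: "length l = n" by (simp add: histories_def)
    define s where "s = (norm (sum_list l))\<^sup>2"
    define x where "x = s + real n powr a + 36"
    define z where "z = s / n + 37"
    have "real n powr a \<le> n" using powr_increment_bounds(4)[OF a, of n] n by simp
    moreover have "36 \<le> 36 * real n" using n by simp
    moreover have "z * n = s + 37 * real n" using n by (simp add: z_def distrib_right)
    ultimately have "x \<le> z * n" unfolding x_def by linarith
    have s: "s \<ge> 0" by (simp add: s_def)
    then have x: "x > 0" and z: "z > 0" using n by (auto simp: x_def z_def add_nonneg_pos)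
    have "ln x \<le> ln (z * n)" using \<open>x \<le> z * n\<close> x by simp
    also have "\<dots> = ln z + ln n" using z n by (simp add: ln_mult_pos)
    also have "ln z \<le> ln A + (z / A - 1)"
      using ln_le_minus_one[of "z / A"] z A by (simp add: ln_div)
    finally have "- log_potential a l \<le> ln A + z / A"
      by (simp add: log_potential_def len x_def s_def)
    moreover have "0 \<le> ln A + z / A" using A z by simp
    moreover have "z / A = 1 / (real n * A) * s + 37 / A"
      by (simp add: z_def add_divide_distrib)
    ultimately show "max 0 (- log_potential a l)
        \<le> 1 / (real n * A) * (norm (\<Sum>u\<leftarrow>l. u))\<^sup>2 + (ln A + 37 / A)"
      by (simp add: s_def)
  qed
  also have "\<dots> = 1 / (real n * A) * path_mean n (\<lambda>l. (norm (\<Sum>u\<leftarrow>l. u))\<^sup>2) + (ln A + 37 / A)"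
    using n by (simp only: path_mean_add path_mean_cmult path_mean_const)
  also have "path_mean n (\<lambda>l. (norm (\<Sum>u\<leftarrow>l. u))\<^sup>2) = real n * harm n"
    by (rule path_mean_norm_sum_sq) (use n in \<open>simp_all add: sum_unit_steps_eq_0 norm_unit_step\<close>)
  also have "1 / (real n * A) * (real n * harm n) + (ln A + 37 / A) = ln A + A / A"
  proof -
    have "1 / (real n * A) * (real n * harm n) = harm n / A" using n by simp
    moreover have "A / A = harm n / A + 37 / A" by (simp only: A_def add_divide_distrib)
    ultimately show ?thesis by simp
  qed
  also have "\<dots> = ln (harm n + 37) + 1" using A by (simp add: A_def)
  finally show ?thesis .
qed

text \<open>
  The potential stays below \<open>e * ln n\<close> eventually. The choice \<open>e = (1 - a) / 2\<close> puts \<open>1 - e\<close> strictly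
  above \<open>a\<close>, so that \<open>n powr (1 - e)\<close> dominates the regularisation \<open>n powr a + 36\<close>.
\<close>

lemma AE_norm_walk_sq_lower:
  fixes S :: "nat \<Rightarrow> 'a \<Rightarrow> real ^ 2"
  assumes "merw M (5 / 8) \<sigma> K S" and a: "3 / 4 \<le> a" "a < 1"
  shows "AE \<omega> in M. eventually (\<lambda>n. real n powr a \<le> (norm (S n \<omega>))\<^sup>2) sequentially"
proof -
  interpret merw M "5 / 8" \<sigma> K S by fact
  define e where "e = (1 - a) / 2"
  have e: "e > 0" using a by (simp add: e_def)
  define C where "C = suminf (mean_drift_error a) + 40"
  have C: "C \<ge> 40"
    using suminf_nonneg[OF summable_mean_drift_error[OF a] mean_drift_error_nonneg] by (simp add: C_def)
  have "AE \<omega> in M. eventually (\<lambda>j. \<forall>k\<in>{1..2 ^ 2 ^ Suc j}.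
      log_potential a (history \<sigma> k \<omega>) < e * (2 ^ j * ln 2)) sequentially"
  proof (rule eventually_below_level[where g = "drift_error a" and b = "\<lambda>j. C * real (Suc j)"])
    fix l :: "(real ^ 2) list" assume "l \<noteq> []" "set l \<subseteq> unit_steps"
    then show "(\<Sum>v\<in>unit_steps. step_prob (5 / 8) l v * log_potential a (v # l))
        \<le> log_potential a l + drift_error a l"
      using a by (intro log_potential_drift) auto
  next
    fix j
    let ?N = "2 ^ 2 ^ Suc j :: nat"
    have "log_potential a [axis 1 1] \<le> 0" by (simp add: log_potential_def)
    moreover have "(\<Sum>k=1..<?N. path_mean k (drift_error a)) \<le> suminf (mean_drift_error a)"
    proof -
      have "(\<Sum>k=1..<?N. path_mean k (drift_error a)) = (\<Sum>k=1..<?N. mean_drift_error a k)"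
        using path_mean_drift_error[OF assms(1)] by (intro sum.cong) auto
      also have "\<dots> \<le> suminf (mean_drift_error a)"
        using summable_mean_drift_error[OF a] mean_drift_error_nonneg by (intro sum_le_suminf) auto
      finally show ?thesis .
    qed
    moreover have "path_mean ?N (\<lambda>l. max 0 (- log_potential a l)) \<le> 40 + real j"
    proof -
      have "path_mean ?N (\<lambda>l. max 0 (- log_potential a l)) \<le> ln (harm ?N + 37) + 1"
        using path_mean_neg_log_potential[OF assms(1), of ?N a] a by simp
      also have "ln (harm ?N + 37) \<le> ln (40 * 2 ^ j :: real)"
      proof -
        have "(1 :: real) \<le> 2 ^ j" by simp
        then have "harm ?N + 37 \<le> 40 * (2 :: real) ^ j" using harm_stage[of j] by linarith
        moreover have "0 < harm ?N + (37 :: real)" using harm_nonneg[of ?N] by (smt (verit))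
        ultimately show ?thesis by simp
      qed
      also have "\<dots> = ln 40 + real j * ln 2" by (simp add: ln_mult_pos ln_realpow)
      also have "\<dots> \<le> 39 + real j * 1"
        using ln_le_minus_one[of 40] ln_le_minus_one[of 2] by (intro add_mono mult_left_mono) auto
      finally show ?thesis by simp
    qed
    moreover have "suminf (mean_drift_error a) + (40 + real j) \<le> C * real (Suc j)"
    proof -
      have "1 * real j \<le> C * real j" using C by (intro mult_right_mono) auto
      then show ?thesis by (simp add: C_def algebra_simps)
    qed
    ultimately show "log_potential a [axis 1 1] + (\<Sum>k=1..<?N. path_mean k (drift_error a))
        + path_mean ?N (\<lambda>l. max 0 (- log_potential a l)) \<le> C * real (Suc j)" by linarith
  next
    have "summable (\<lambda>j. real (Suc j) * (1 / 2 :: real) ^ j)"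
      using geometric_deriv_sums[of "1 / 2 :: real"] by (simp add: sums_iff)
    then have "summable (\<lambda>j. C / (e * ln 2) * (real (Suc j) * (1 / 2) ^ j))" by (rule summable_mult)
    moreover have "C / (e * ln 2) * (real (Suc j) * (1 / 2) ^ j) = C * real (Suc j) / (e * (2 ^ j * ln 2))" for j
      by (simp add: power_one_over)
    ultimately show "summable (\<lambda>j. C * real (Suc j) / (e * (2 ^ j * ln 2)))" by (simp only:)
  qed (use e in \<open>auto simp: drift_error_nonneg\<close>)
  then show ?thesis
    using AE_space
  proof eventually_elim
    case (elim \<omega>)
    have "eventually (\<lambda>n. 2 * real n powr a + 36 \<le> real n powr ((1 + a) / 2)) sequentially"
      using a by real_asymp
    then show ?case
      using eventually_stage[OF elim(1)] eventually_ge_at_top[of 1]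
    proof eventually_elim
      case (elim n)
      then obtain j where j: "2 ^ 2 ^ j \<le> n" "log_potential a (history \<sigma> n \<omega>) < e * (2 ^ j * ln 2)"
        by blast
      define x where "x = (norm (S n \<omega>))\<^sup>2 + real n powr a + 36"
      have x: "x > 0" unfolding x_def by (intro add_nonneg_pos add_nonneg_nonneg) auto
      have "e * (2 ^ j * ln 2) \<le> e * ln (real n)"
        using stage_ln[OF j(1)] e by (intro mult_left_mono) auto
      then have "ln (real n) - ln x < e * ln (real n)"
        using j(2) walk_eq_sum_history[OF \<open>\<omega> \<in> space M\<close>, of n] by (simp add: log_potential_def x_def)
      then have "(1 - e) * ln (real n) < ln x" by (simp add: algebra_simps)
      then have "ln (real n powr (1 - e)) < ln x" using elim(3) by (simp add: ln_powr)
      then have "real n powr (1 - e) < x" using x elim(3) by (subst (asm) ln_less_cancel_iff) auto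
      moreover have "1 - e = (1 + a) / 2" by (simp add: e_def field_simps)
      ultimately show ?case using elim(1) by (simp add: x_def)
    qed
  qed
qed

section \<open>The growth exponent\<close>

theorem proposition1p6:
  fixes M :: "'a measure"
    and \<sigma> :: "nat \<Rightarrow> 'a \<Rightarrow> real ^ 2"
    and K :: "nat \<Rightarrow> 'a \<Rightarrow> nat"
    and S :: "nat \<Rightarrow> 'a \<Rightarrow> real ^ 2"
  assumes "merw M (5 / 8) \<sigma> K S"
  shows "AE \<omega> in M. ((\<lambda>n. eln ((norm (S n \<omega>))\<^sup>2) / eln (real n)) \<longlongrightarrow> 1) sequentially"
proof -
  interpret merw M "5 / 8" \<sigma> K S by fact
  define a where "a = (\<lambda>m. 1 - 1 / (real m + 4))"
  have a: "3 / 4 \<le> a m" "a m < 1" for m by (simp_all add: a_def field_simps)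
  have "AE \<omega> in M. \<forall>m. eventually (\<lambda>n. real n powr a m \<le> (norm (S n \<omega>))\<^sup>2) sequentially"
    unfolding AE_all_countable using AE_norm_walk_sq_lower[OF assms a] by blast
  moreover have "AE \<omega> in M. eventually (\<lambda>n. (norm (S n \<omega>))\<^sup>2
      \<le> real n * (1 + ln (real n) + 4 * (ln (real n))\<^sup>2)) sequentially"
    by (rule AE_norm_walk_sq_upper) simp
  ultimately show ?thesis
  proof eventually_elim
    case (elim \<omega>)
    let ?s = "\<lambda>n. (norm (S n \<omega>))\<^sup>2"
    have pos: "eventually (\<lambda>n. n \<ge> 2 \<and> ?s n > 0) sequentially"
      using elim(1)[rule_format, of 0] eventually_ge_at_top[of 2]
    proof eventually_elim
      case (elim n)
      have "0 < real n powr a 0" using elim(2) by simp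
      with elim show ?case by linarith
    qed
    have "((\<lambda>n. ln (?s n) / ln (real n)) \<longlongrightarrow> 1) sequentially"
    proof (rule order_tendstoI)
      fix y :: real assume "y < 1"
      have "(a \<longlongrightarrow> 1) sequentially" unfolding a_def by real_asymp
      then obtain m where m: "y < a m"
        using \<open>y < 1\<close> by (metis order_tendstoD(1) eventually_happens' sequentially_bot)
      show "eventually (\<lambda>n. y < ln (?s n) / ln (real n)) sequentially"
        using elim(1)[rule_format, of m] pos
      proof eventually_elim
        case (elim n)
        then have "ln (real n powr a m) \<le> ln (?s n)" by (subst ln_le_cancel_iff) auto
        then have "a m \<le> ln (?s n) / ln (real n)" using elim by (simp add: ln_powr le_divide_eq)
        with m show ?case by linarith
      qed
    next
      fix y :: real assume "1 < y"
      define b where "b = (\<lambda>n. ln (real n * (1 + ln (real n) + 4 * (ln (real n))\<^sup>2)) / ln (real n))"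
      have "(b \<longlongrightarrow> 1) sequentially" unfolding b_def by real_asymp
      then have "eventually (\<lambda>n. b n < y) sequentially" using \<open>1 < y\<close> by (rule order_tendstoD)
      then show "eventually (\<lambda>n. ln (?s n) / ln (real n) < y) sequentially"
        using elim(2) pos
      proof eventually_elim
        case (elim n)
        then have "0 < real n * (1 + ln (real n) + 4 * (ln (real n))\<^sup>2)" by linarith
        then have "ln (?s n) \<le> ln (real n * (1 + ln (real n) + 4 * (ln (real n))\<^sup>2))"
          using elim(2,3) ln_le_cancel_iff by blast
        then have "ln (?s n) / ln (real n) \<le> b n"
          using elim unfolding b_def by (intro divide_right_mono) auto
        with elim show ?case by linarith
      qed
    qed
    then have "((\<lambda>n. ereal (ln (?s n) / ln (real n))) \<longlongrightarrow> 1) sequentially"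
      by (simp add: one_ereal_def)
    moreover have "eventually (\<lambda>n. ereal (ln (?s n) / ln (real n)) = eln (?s n) / eln (real n)) sequentially"
      using pos by eventually_elim (simp add: eln_def)
    ultimately show ?case by (rule Lim_transform_eventually)
  qed
qed

end
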